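(* Let $c(n)=\sum_{0\le r,s,t\le n}\frac{n!}{r!\,s!\,t!\,(n-r-s-t)!}r^{n-r-s-t}s^{n-r-s+1}$ (with $0^0=1$, $1/m!=0$ for negative $m$). Then, as $n\to\infty$, $$c(n)\sim e^{\frac n{s_n}(n-r_n+\frac12)-3n+2r_n+2s_n+t_n+1}\Big(\frac n{s_n}\Big)^n\frac{r_n^{1/2}s_n^{3/2}}{n}\sim e^{\frac n{s_n}(n-r_n+\frac12)-3n+2r_n+2s_n+t_n+1}\Big(\frac n{s_n}\Big)^n\frac{n}{4\log^2 n},$$ where $(r_n,s_n,t_n)$ is, for large $n$, the unique solution with $r,s,t>0$, $r+s+t<n$ of the system $$-\log r-\log s+\frac{n-r-s-t}{r}-\psi(r+1)+\psi(n-r-s-t+1)=0,$$ $$-\log r-\log s+\frac{n-r-s+1}{s}-\psi(s+1)+\psi(n-r-s-t+1)=0,$$ $$-\log r-\psi(t+1)+\psi(n-r-s-t+1)=0.$$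
   Context: $\psi$ denotes the digamma function $\Gamma'/\Gamma$. *)

theory Defs
  imports "HOL-Analysis.Analysis" "HOL-Library.Landau_Symbols"
begin

(* The guard r + s + t \<le> n renders the convention 1/m! = 0 for m < 0, and it makes every
   natural-number subtraction below exact. *)
definition c :: "nat \<Rightarrow> real" where
  "c n = (\<Sum>r\<le>n. \<Sum>s\<le>n. \<Sum>t\<le>n.
     if r + s + t \<le> n
     then fact n / (fact r * fact s * fact t * fact (n - r - s - t))
            * real r ^ (n - r - s - t) * real s ^ (n - r - s + 1)
     else 0)"

definition saddle_point :: "nat \<Rightarrow> real \<Rightarrow> real \<Rightarrow> real \<Rightarrow> bool" where
  "saddle_point n r s t \<longleftrightarrow>
     r > 0 \<and> s > 0 \<and> t > 0 \<and> r + s + t < real n \<and>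
     - ln r - ln s + (real n - r - s - t) / r - Digamma (r + 1)
       + Digamma (real n - r - s - t + 1) = 0 \<and>
     - ln r - ln s + (real n - r - s + 1) / s - Digamma (s + 1)
       + Digamma (real n - r - s - t + 1) = 0 \<and>
     - ln r - Digamma (t + 1) + Digamma (real n - r - s - t + 1) = 0"

end

theory Submission
  imports Defs "HOL-Probability.Distributions" "HOL-Real_Asymp.Real_Asymp"
begin

text \<open>
  Summing over \<open>t\<close> by the binomial theorem turns \<open>c n\<close> into the double sum of
  \<open>n! / (r! s! m!) * s ^ (m + 1) * (1 + r) ^ m\<close> with \<open>m = n - r - s\<close>. Its logarithm has
  Hessian \<open>- (m / r\<^sup>2, m / s\<^sup>2)\<close> on the diagonal, of order \<open>4 (ln n)\<^sup>2 / n\<close>, and a mixed derivative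
  smaller by a factor \<open>ln n\<close>; so the rescaled summands tend to a standard Gaussian, and the sum is
  \<open>2 * pi * n / (4 (ln n)\<^sup>2)\<close> times the peak.

  The point \<open>(r\<^sub>n, s\<^sub>n)\<close> of the three-variable system is not exactly critical for the double sum,
  but the gradient there is \<open>O(ln n / n)\<close>, which displaces the maximum by much less than the width
  \<open>sqrt n / (2 ln n)\<close> of the peak. The peak value is then simplified with the saddle point equations
  and \<open>Digamma (x + 1) = ln x + 1 / (2 x) + O(1 / x\<^sup>2)\<close>.

  Every saddle point for large \<open>n\<close> satisfies \<open>r \<sim> s \<sim> n / (2 ln n)\<close>, \<open>t \<sim> 2 ln n\<close>, a region
  in which the logarithm of the summand of \<open>c n\<close> is strictly concave; this gives uniqueness. Existence
  comes from maximising that logarithm over a box on whose faces its gradient points inwards.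
\<close>

section \<open>Bounds for the polygamma functions\<close>

lemma Digamma_add_of_nat_minus_ln_tendsto:
  fixes x :: real
  assumes "x > 0"
  shows "(\<lambda>n. Digamma (x + real n) - ln (real n)) \<longlonglongrightarrow> 0"
proof -
  have "x \<noteq> - real k" for k
    using assms of_nat_0_le_iff[of k, where ?'a = real] by linarith
  then have "Digamma (x + real n) = Digamma x + (\<Sum>k<n. inverse (x + real k))" for n
    using Polygamma_plus_of_nat[of n x 0] by (simp add: inverse_eq_divide)
  moreover have "(\<lambda>n. Digamma x - (ln (real n) - (\<Sum>k<n. inverse (x + real k))))
      \<longlonglongrightarrow> Digamma x - Digamma x"
    using Digamma_LIMSEQ[of x] assms by (intro tendsto_diff tendsto_const) simp
  ultimately show ?thesis by (simp add: algebra_simps)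
qed

text \<open>Both comparisons hold because \<open>n \<mapsto> g (x + n) - Digamma (x + n)\<close> is monotone with limit \<open>0\<close>.\<close>

context
  fixes g d :: "real \<Rightarrow> real" and x :: real
  assumes x: "x > 0" and g: "(\<lambda>n. g (x + real n) - ln (real n)) \<longlonglongrightarrow> 0"
  defines "d \<equiv> \<lambda>y. g y - Digamma y"
begin

lemma Digamma_gap_tendsto: "(\<lambda>n. d (x + real n)) \<longlonglongrightarrow> 0"
  using tendsto_diff[OF g Digamma_add_of_nat_minus_ln_tendsto[OF x]] by (simp add: d_def)

lemma Digamma_gap_Suc:
  "d (x + real (Suc n)) =
    d (x + real n) + (g (x + real n + 1) - g (x + real n)) - 1 / (x + real n)"
proof -
  have "Digamma (x + real n + 1) = Digamma (x + real n) + 1 / (x + real n)"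
    using x by (intro Digamma_plus1) linarith
  then show ?thesis by (simp add: d_def add_ac)
qed

lemma Digamma_leI:
  assumes "\<And>y. y \<ge> x \<Longrightarrow> g (y + 1) - g y \<le> 1 / y"
  shows "Digamma x \<le> g x"
proof -
  have "d (x + real (Suc n)) \<le> d (x + real n)" for n
    using assms[of "x + real n"] unfolding Digamma_gap_Suc by simp
  then have "decseq (\<lambda>n. d (x + real n))" by (rule decseq_SucI)
  then have "d (x + real 0) \<ge> 0" using Digamma_gap_tendsto by (rule decseq_ge)
  then show ?thesis by (simp add: d_def)
qed

lemma Digamma_geI:
  assumes "\<And>y. y \<ge> x \<Longrightarrow> g (y + 1) - g y \<ge> 1 / y"
  shows "Digamma x \<ge> g x"
proof -
  have "d (x + real n) \<le> d (x + real (Suc n))" for n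
    using assms[of "x + real n"] unfolding Digamma_gap_Suc by simp
  then have "incseq (\<lambda>n. d (x + real n))" by (rule incseq_SucI)
  then have "d (x + real 0) \<le> 0" using Digamma_gap_tendsto by (rule incseq_le)
  then show ?thesis by (simp add: d_def)
qed

end

lemma Digamma_le_ln:
  fixes x :: real
  assumes "x > 0"
  shows "Digamma x \<le> ln x"
proof (rule Digamma_leI[OF assms])
  fix y assume "y \<ge> x"
  then have y: "y > 0" using assms by simp
  then have "ln (y + 1) - ln y = ln (1 + 1 / y)"
    by (subst ln_divide_pos [symmetric]) (auto simp: field_simps)
  also have "\<dots> \<le> 1 / y" using y by (intro ln_add_one_self_le_self) simp
  finally show "ln (y + 1) - ln y \<le> 1 / y" .
qed real_asymp

lemma ln_le_Digamma_plus_half: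
  fixes x :: real
  assumes "x > 0"
  shows "ln x \<le> Digamma (x + 1 / 2)"
proof -
  have "ln (x + 1 / 2 - 1 / 2) \<le> Digamma (x + 1 / 2)"
  proof (rule Digamma_geI)
    fix y assume "y \<ge> x + 1 / 2"
    then show "ln (y + 1 - 1 / 2) - ln (y - 1 / 2) \<ge> 1 / y"
      using assms ln_inverse_approx_ge[of "y - 1 / 2" "y + 1 - 1 / 2"] by (simp add: field_simps)
  next
    show "(\<lambda>n. ln (x + 1 / 2 + real n - 1 / 2) - ln (real n)) \<longlonglongrightarrow> 0" by real_asymp
  qed (use assms in simp)
  then show ?thesis by simp
qed

lemma Digamma_le_ln_minus:
  fixes x :: real
  assumes "x > 0"
  shows "Digamma x \<le> ln x - 1 / (2 * x)"
proof (rule Digamma_leI[OF assms])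
  fix y assume "y \<ge> x"
  then have y: "y > 0" using assms by simp
  have "ln (y + 1) - ln y \<le> 1 / (2 * y) + 1 / (2 * (y + 1))"
    using ln_inverse_approx_le[OF y zero_less_one]
    by (simp add: inverse_eq_divide add_divide_distrib algebra_simps)
  moreover have "1 / y = 1 / (2 * y) + 1 / (2 * y)" by simp
  ultimately show "ln (y + 1) - 1 / (2 * (y + 1)) - (ln y - 1 / (2 * y)) \<le> 1 / y"
    by linarith
qed real_asymp

lemma Digamma_plus1_bounds:
  fixes x :: real
  assumes "x > 0"
  shows Digamma_plus1_le_ln: "Digamma (x + 1) \<le> ln (x + 1)"
    and ln_plus_half_le_Digamma_plus1: "ln (x + 1 / 2) \<le> Digamma (x + 1)"
    and ln_le_Digamma_plus1: "ln x \<le> Digamma (x + 1)"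
    and Digamma_plus1_le_ln_plus: "Digamma (x + 1) \<le> ln x + 1 / (2 * x)"
proof -
  show "Digamma (x + 1) \<le> ln (x + 1)" using assms by (intro Digamma_le_ln) simp
  show half: "ln (x + 1 / 2) \<le> Digamma (x + 1)"
    using ln_le_Digamma_plus_half[of "x + 1 / 2"] assms by (simp add: add.commute)
  have "ln x \<le> ln (x + 1 / 2)" using assms by simp
  then show "ln x \<le> Digamma (x + 1)" using half by (rule order_trans)
  have "Digamma (x + 1) = Digamma x + 1 / x" using assms by (intro Digamma_plus1) simp
  moreover have "1 / x = 1 / (2 * x) + 1 / (2 * x)" by simp
  ultimately show "Digamma (x + 1) \<le> ln x + 1 / (2 * x)"
    using Digamma_le_ln_minus[OF assms] by linarith
qed

lemma inverse_telescope_sums: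
  fixes x :: real
  shows "(\<lambda>k. 1 / (x + real k) - 1 / (x + real (Suc k))) sums (1 / x)"
proof -
  have "(\<lambda>k. 1 / (x + real k)) \<longlonglongrightarrow> 0" by real_asymp
  from telescope_sums'[OF this] show ?thesis by simp
qed

lemma Polygamma1_sums:
  fixes x :: real
  assumes "x > 0"
  shows "(\<lambda>k. inverse ((x + real k)\<^sup>2)) sums Polygamma 1 x"
proof -
  have "x \<noteq> - of_nat n" for n using assms by (metis neg_le_0_iff_le not_le of_nat_0_le_iff)
  then show ?thesis
    using Polygamma_LIMSEQ[of x 1] assms by (simp add: numeral_2_eq_2)
qed

lemma Polygamma1_plus1_le:
  fixes x :: real
  assumes "x > 0"
  shows "Polygamma 1 (x + 1) \<le> 1 / x"
proof (rule sums_le[OF _ Polygamma1_sums inverse_telescope_sums])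
  fix k
  have "x + real k > 0" using assms by simp
  then show "inverse ((x + 1 + real k)\<^sup>2) \<le> 1 / (x + real k) - 1 / (x + real (Suc k))"
    by (simp add: divide_simps add_ac power2_eq_square)
qed (use assms in auto)

lemma Polygamma1_ge:
  fixes x :: real
  assumes "x > 0"
  shows "1 / x \<le> Polygamma 1 x"
proof (rule sums_le[OF _ inverse_telescope_sums Polygamma1_sums])
  fix k
  have "x + real k > 0" using assms by simp
  then show "1 / (x + real k) - 1 / (x + real (Suc k)) \<le> inverse ((x + real k)\<^sup>2)"
    by (simp add: divide_simps add_ac power2_eq_square)
qed (use assms in auto)

lemma Polygamma1_pos:
  fixes x :: real
  assumes "x > 0"
  shows "Polygamma 1 x > 0"
  using Polygamma1_ge[OF assms] assms by (meson divide_pos_pos less_le_trans zero_less_one)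

lemma Polygamma1_plus1_asymp_equiv: "(\<lambda>x :: real. Polygamma 1 (x + 1)) \<sim>[at_top] (\<lambda>x. 1 / x)"
proof (rule asymp_equiv_sandwich_real)
  show "\<forall>\<^sub>F x :: real in at_top. Polygamma 1 (x + 1) \<in> {1 / (x + 1)..1 / x}"
    using eventually_gt_at_top[of 0]
    by eventually_elim (simp add: Polygamma1_ge Polygamma1_plus1_le del: One_nat_def)
  show "(\<lambda>x :: real. 1 / (x + 1)) \<sim>[at_top] (\<lambda>x. 1 / x)" by real_asymp
qed simp

lemma Digamma_plus1_diff_le:
  fixes x y :: real
  assumes "0 < x" "x \<le> y"
  shows "Digamma (y + 1) - Digamma (x + 1) \<le> (y - x) / x"
proof (cases "x = y")
  case False
  have "\<exists>z>x. z < y \<and> Digamma (y + 1) - Digamma (x + 1) = (y - x) * Polygamma 1 (z + 1)"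
    using assms False
    by (intro MVT2[where f = "\<lambda>z. Digamma (z + 1)"])
       (auto intro!: derivative_eq_intros elim!: nonpos_Ints_cases)
  then obtain z where z: "z > x"
    and diff: "Digamma (y + 1) - Digamma (x + 1) = (y - x) * Polygamma 1 (z + 1)" by blast
  have "Polygamma 1 (z + 1) \<le> 1 / z" using assms z by (intro Polygamma1_plus1_le) simp
  also have "\<dots> \<le> 1 / x" using assms z by (intro divide_left_mono) auto
  finally have "(y - x) * Polygamma 1 (z + 1) \<le> (y - x) * (1 / x)"
    using assms by (intro mult_left_mono) auto
  then show ?thesis by (simp add: diff)
qed simp

section \<open>Stirling's formula for the log-gamma function\<close>

definition digamma_error :: "real \<Rightarrow> real" where
  "digamma_error x = Digamma (x + 1) - ln x - 1 / (2 * x)"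

lemma digamma_error_bounds:
  assumes "x > 0"
  shows digamma_error_nonpos: "digamma_error x \<le> 0"
    and digamma_error_ge: "- (1 / (8 * x\<^sup>2)) \<le> digamma_error x"
proof -
  show "digamma_error x \<le> 0"
    using Digamma_plus1_le_ln_plus[OF assms] by (simp add: digamma_error_def)
  have "1 / (2 * x) - 1 / (8 * x\<^sup>2) \<le> 2 / (4 * x + 1)"
    using assms by (simp add: divide_simps power2_eq_square) (simp add: algebra_simps)
  also have "\<dots> \<le> ln (x + 1 / 2) - ln x"
    using ln_inverse_approx_ge[of x "x + 1 / 2"] assms by (simp add: field_simps)
  also have "\<dots> \<le> Digamma (x + 1) - ln x"
    using ln_plus_half_le_Digamma_plus1[OF assms] by simp
  finally show "- (1 / (8 * x\<^sup>2)) \<le> digamma_error x" by (simp add: digamma_error_def)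
qed

lemma digamma_error_bigo: "digamma_error \<in> O[at_top](\<lambda>x. 1 / x\<^sup>2)"
proof (rule bigoI[where c = "1 / 8"])
  show "\<forall>\<^sub>F x in at_top. norm (digamma_error x) \<le> 1 / 8 * norm (1 / x\<^sup>2)"
    using eventually_gt_at_top[of 0]
  proof eventually_elim
    case (elim x)
    then show ?case using digamma_error_bounds[OF elim] by simp
  qed
qed

definition stirling_error :: "real \<Rightarrow> real" where
  "stirling_error x = ln_Gamma x - (x - 1 / 2) * ln x + x"

lemma ln_Gamma_plus1_eq_stirling:
  fixes x :: real
  assumes "x > 0"
  shows "ln_Gamma (x + 1) = x * ln x + ln x / 2 - x + stirling_error x"
proof -
  have "Gamma (x + 1) = x * Gamma x"
    using assms by (intro Gamma_plus1) auto
  then have "ln_Gamma (x + 1) = ln x + ln_Gamma x"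
    using assms by (simp add: ln_Gamma_real_pos ln_mult_pos Gamma_real_pos)
  then show ?thesis unfolding stirling_error_def by (simp add: algebra_simps)
qed

lemma has_real_derivative_stirling_error:
  assumes "x > 0"
  shows "(stirling_error has_real_derivative digamma_error x) (at x)"
proof -
  have "(stirling_error has_real_derivative (Digamma x - (ln x + (x - 1 / 2) / x) + 1)) (at x)"
    unfolding stirling_error_def [abs_def] using assms
    by (auto intro!: derivative_eq_intros)
  also have "Digamma x - (ln x + (x - 1 / 2) / x) + 1 = digamma_error x"
    unfolding digamma_error_def using assms by (subst Digamma_plus1) (auto simp: field_simps)
  finally show ?thesis .
qed

lemma stirling_error_antimono:
  assumes "0 < x" "x \<le> y"
  shows "stirling_error y \<le> stirling_error x"
proof (rule DERIV_nonpos_imp_nonincreasing[OF assms(2)])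
  fix z assume "x \<le> z" "z \<le> y"
  then show "\<exists>D. (stirling_error has_real_derivative D) (at z) \<and> D \<le> 0"
    using assms has_real_derivative_stirling_error[of z] digamma_error_nonpos[of z] by auto
qed

lemma stirling_error_diff_le:
  assumes "0 < x" "x \<le> y"
  shows "stirling_error x - stirling_error y \<le> 1 / (8 * x)"
proof -
  have "stirling_error x - 1 / (8 * x) \<le> stirling_error y - 1 / (8 * y)"
  proof (rule DERIV_nonneg_imp_nondecreasing[OF assms(2)])
    fix z assume "x \<le> z" "z \<le> y"
    then have z: "z > 0" using assms by simp
    have "((\<lambda>z. stirling_error z - 1 / (8 * z)) has_real_derivative
        (digamma_error z + 1 / (8 * z\<^sup>2))) (at z)"
      using z by (auto intro!: derivative_eq_intros has_real_derivative_stirling_error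
          simp: power2_eq_square field_simps)
    then show "\<exists>D. ((\<lambda>z. stirling_error z - 1 / (8 * z)) has_real_derivative D) (at z) \<and> 0 \<le> D"
      using digamma_error_ge[OF z] by (intro exI conjI) auto
  qed
  moreover have "1 / (8 * y) \<ge> 0" using assms by simp
  ultimately show ?thesis by linarith
qed

lemma stirling_error_convergent: "\<exists>l. (stirling_error \<longlongrightarrow> l) at_top"
proof -
  have "decseq (\<lambda>n. stirling_error (real (Suc n)))"
    by (rule decseq_SucI) (auto intro!: stirling_error_antimono)
  moreover have "stirling_error 1 - 1 / 8 \<le> stirling_error (real (Suc n))" for n
    using stirling_error_diff_le[of 1 "real (Suc n)"] by simp
  ultimately obtain l where l: "(\<lambda>n. stirling_error (real (Suc n))) \<longlonglongrightarrow> l"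
    using decseq_convergent by blast
  have lower: "l \<le> stirling_error x" and upper: "stirling_error x - 1 / (8 * x) \<le> l"
    if x: "x > 0" for x
  proof -
    have later: "\<forall>\<^sub>F n in sequentially. x \<le> real (Suc n)" by real_asymp
    show "l \<le> stirling_error x"
      using later by (intro tendsto_upperbound[OF l], eventually_elim)
        (auto intro: stirling_error_antimono x)
    show "stirling_error x - 1 / (8 * x) \<le> l"
      using later by (intro tendsto_lowerbound[OF l], eventually_elim)
        (auto dest: stirling_error_diff_le[OF x])
  qed
  have "(stirling_error \<longlongrightarrow> l) at_top"
  proof (rule tendsto_sandwich)
    show "\<forall>\<^sub>F x in at_top. l \<le> stirling_error x" "\<forall>\<^sub>F x in at_top. stirling_error x \<le> l + 1 / (8 * x)"
      using eventually_gt_at_top[of 0]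
      by (eventually_elim, use lower upper in \<open>auto simp: algebra_simps\<close>)+
    show "((\<lambda>x. l + 1 / (8 * x)) \<longlongrightarrow> l) at_top" by real_asymp
  qed simp
  then show ?thesis by blast
qed

lemma ln_Gamma_legendre_duplication:
  fixes x :: real
  assumes "x > 0"
  shows "ln_Gamma x + ln_Gamma (x + 1 / 2) = (1 - 2 * x) * ln 2 + ln pi / 2 + ln_Gamma (2 * x)"
proof -
  define z where "z = complex_of_real x"
  have half: "z + 1 / 2 = of_real (x + 1 / 2)" by (simp add: z_def)
  have "z \<notin> \<int>\<^sub>\<le>\<^sub>0" "z + 1 / 2 \<notin> \<int>\<^sub>\<le>\<^sub>0"
    using assms by (auto elim!: nonpos_Ints_cases simp: z_def complex_eq_iff)
  then have "Gamma z * Gamma (z + 1 / 2) =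
      exp ((1 - 2 * z) * of_real (ln 2)) * of_real (sqrt pi) * Gamma (2 * z)"
    by (rule Gamma_legendre_duplication)
  also have "Gamma z * Gamma (z + 1 / 2) = of_real (Gamma x * Gamma (x + 1 / 2))"
    unfolding half by (simp only: z_def Gamma_complex_of_real of_real_mult)
  also have "exp ((1 - 2 * z) * of_real (ln 2)) * of_real (sqrt pi) * Gamma (2 * z)
      = of_real (exp ((1 - 2 * x) * ln 2) * sqrt pi * Gamma (2 * x))"
    by (simp add: z_def exp_of_real [symmetric] Gamma_complex_of_real [symmetric])
  finally have "Gamma x * Gamma (x + 1 / 2) = exp ((1 - 2 * x) * ln 2) * sqrt pi * Gamma (2 * x)"
    using of_real_eq_iff by blast
  then have "ln (Gamma x * Gamma (x + 1 / 2)) =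
      ln (exp ((1 - 2 * x) * ln 2) * sqrt pi * Gamma (2 * x))"
    by (rule arg_cong)
  then show ?thesis
    using assms by (simp add: ln_mult_pos ln_Gamma_real_pos Gamma_real_pos ln_sqrt)
qed

lemma stirling_error_duplication:
  assumes "x > 0"
  shows "stirling_error x + stirling_error (x + 1 / 2) - stirling_error (2 * x)
    = ln (2 * pi) / 2 + (1 / 2 - x * ln (1 + 1 / (2 * x)))"
proof -
  have "1 + 1 / (2 * x) = (x + 1 / 2) / x" using assms by (simp add: field_simps)
  then have ratio: "ln (1 + 1 / (2 * x)) = ln (x + 1 / 2) - ln x" using assms by (simp add: ln_div)
  have double: "ln (2 * x) = ln 2 + ln x" "ln (2 * pi) = ln 2 + ln pi"
    using assms by (simp_all add: ln_mult_pos)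
  show ?thesis
    using ln_Gamma_legendre_duplication[OF assms] unfolding stirling_error_def ratio double
    by (simp add: algebra_simps add_divide_distrib)
qed

lemma stirling_error_tendsto: "(stirling_error \<longlongrightarrow> ln (2 * pi) / 2) at_top"
proof -
  obtain l where l: "(stirling_error \<longlongrightarrow> l) at_top"
    using stirling_error_convergent by blast
  have "((\<lambda>x. stirling_error x + stirling_error (x + 1 / 2) - stirling_error (2 * x))
      \<longlongrightarrow> l + l - l) at_top"
    by (intro tendsto_intros l filterlim_compose[OF l]) real_asymp+
  moreover have "\<forall>\<^sub>F x in at_top.
      stirling_error x + stirling_error (x + 1 / 2) - stirling_error (2 * x)
        = ln (2 * pi) / 2 + (1 / 2 - x * ln (1 + 1 / (2 * x)))"
    using eventually_gt_at_top[of 0] by eventually_elim (rule stirling_error_duplication)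
  ultimately have "((\<lambda>x. ln (2 * pi) / 2 + (1 / 2 - x * ln (1 + 1 / (2 * x)))) \<longlongrightarrow> l) at_top"
    by (simp add: tendsto_cong)
  moreover have "((\<lambda>x. ln (2 * pi) / 2 + (1 / 2 - x * ln (1 + 1 / (2 * x))))
      \<longlongrightarrow> ln (2 * pi) / 2) at_top"
  proof -
    have "((\<lambda>x :: real. 1 / 2 - x * ln (1 + 1 / (2 * x))) \<longlongrightarrow> 0) at_top" by real_asymp
    from tendsto_add[OF tendsto_const this] show ?thesis by simp
  qed
  ultimately have "l = ln (2 * pi) / 2"
    by (intro tendsto_unique[of "at_top :: real filter"]) auto
  then show ?thesis using l by (simp only:)
qed

section \<open>Existence and local uniqueness of the saddle point\<close>

text \<open>The logarithm of the summand of \<open>c n\<close>, up to the constant \<open>ln (n!)\<close>.\<close>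

definition phase :: "real \<Rightarrow> real \<Rightarrow> real \<Rightarrow> real \<Rightarrow> real" where
  "phase n r s t = (n - r - s - t) * ln r + (n - r - s + 1) * ln s
     - ln_Gamma (r + 1) - ln_Gamma (s + 1) - ln_Gamma (t + 1) - ln_Gamma (n - r - s - t + 1)"

definition phase_r :: "real \<Rightarrow> real \<Rightarrow> real \<Rightarrow> real \<Rightarrow> real" where
  "phase_r n r s t = - ln r - ln s + (n - r - s - t) / r - Digamma (r + 1)
     + Digamma (n - r - s - t + 1)"

definition phase_s :: "real \<Rightarrow> real \<Rightarrow> real \<Rightarrow> real \<Rightarrow> real" where
  "phase_s n r s t = - ln r - ln s + (n - r - s + 1) / s - Digamma (s + 1)
     + Digamma (n - r - s - t + 1)"

definition phase_t :: "real \<Rightarrow> real \<Rightarrow> real \<Rightarrow> real \<Rightarrow> real" where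
  "phase_t n r s t = - ln r - Digamma (t + 1) + Digamma (n - r - s - t + 1)"

lemma has_real_derivative_phase:
  assumes "r > 0" "s > 0" "t > 0" "r + s + t < n"
  shows "((\<lambda>x. phase n x s t) has_real_derivative phase_r n r s t) (at r)"
    and "((\<lambda>x. phase n r x t) has_real_derivative phase_s n r s t) (at s)"
    and "((\<lambda>x. phase n r s x) has_real_derivative phase_t n r s t) (at t)"
  unfolding phase_def phase_r_def phase_s_def phase_t_def using assms
  by (auto intro!: derivative_eq_intros simp: field_simps)

lemma saddle_point_iff:
  "saddle_point n r s t \<longleftrightarrow> r > 0 \<and> s > 0 \<and> t > 0 \<and> r + s + t < real n \<and>
     phase_r n r s t = 0 \<and> phase_s n r s t = 0 \<and> phase_t n r s t = 0"
  by (simp add: saddle_point_def phase_r_def phase_s_def phase_t_def)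

lemma continuous_on_ln_Gamma_real: "continuous_on {0<..} (ln_Gamma :: real \<Rightarrow> real)"
  by (intro continuous_at_imp_continuous_on ballI
      DERIV_isCont[OF has_field_derivative_ln_Gamma_real]) auto

lemma DERIV_nonpos_at_right_max:
  fixes g :: "real \<Rightarrow> real"
  assumes "x < b" and der: "(g has_real_derivative D) (at x)" and max: "\<And>y. y \<in> {x..b} \<Longrightarrow> g y \<le> g x"
  shows "D \<le> 0"
proof (rule ccontr)
  assume "\<not> D \<le> 0"
  then obtain d where d: "d > 0" "\<And>h. 0 < h \<Longrightarrow> h < d \<Longrightarrow> g x < g (x + h)"
    using DERIV_pos_inc_right[OF der] by auto
  define h where "h = min (d / 2) (b - x)"
  have "g x < g (x + h)" using d(1) \<open>x < b\<close> by (intro d(2)) (auto simp: h_def min_def)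
  moreover have "g (x + h) \<le> g x" using d(1) \<open>x < b\<close> by (intro max) (auto simp: h_def min_def)
  ultimately show False by simp
qed

lemma DERIV_zero_at_max_inward:
  fixes g :: "real \<Rightarrow> real"
  assumes x: "x \<in> {a..b}"
    and der: "(g has_real_derivative D) (at x)"
    and max: "\<And>y. y \<in> {a..b} \<Longrightarrow> g y \<le> g x"
    and left: "x = a \<Longrightarrow> D > 0" and right: "x = b \<Longrightarrow> D < 0"
  shows "D = 0"
proof (rule antisym)
  show "D \<le> 0"
  proof (cases "x = b")
    case False
    show ?thesis by (rule DERIV_nonpos_at_right_max[OF _ der, of b]) (use x False max in auto)
  qed (use right in simp)
  show "0 \<le> D"
  proof (cases "x = a")
    case False
    have "((\<lambda>y. g (- y)) has_real_derivative - D) (at (- x))"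
      using der by (simp add: DERIV_mirror [symmetric])
    then have "- D \<le> 0"
      by (rule DERIV_nonpos_at_right_max[of "- x" "- a", rotated])
         (use x False in \<open>auto intro!: max\<close>)
    then show ?thesis by simp
  qed (use left in simp)
qed

text \<open>The box is centred logarithmically at \<open>r = s = n / (2 ln n)\<close>, \<open>t = 2 ln n\<close>.\<close>

locale saddle_box =
  fixes n L a b p q :: real
  defines "L \<equiv> ln n" and "a \<equiv> n / (4 * L)" and "b \<equiv> n / L" and "p \<equiv> L / 2" and "q \<equiv> 8 * L"
  assumes n_gt_1: "n > 1" and L_gt_3: "L > 3" and a_ge_1: "a \<ge> 1" and b_less: "b + 1 \<le> n"
    and rest_ge: "9 / 10 * n \<le> n - 2 * b - q" and ln_4L_less: "3 * ln (4 * L) + 1 < L"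
begin

lemma sides_ordered: "0 < a" "a < b" "0 < p" "p < q"
  using n_gt_1 L_gt_3 by (auto simp: a_def b_def p_def q_def field_simps)

lemma rest_bounds:
  assumes "r \<in> {a..b}" "s \<in> {a..b}" "t \<in> {p..q}"
  shows "9 / 10 * n \<le> n - r - s - t" "n - r - s - t + 1 \<le> n"
  using assms a_ge_1 sides_ordered rest_ge by auto

lemma Digamma_rest_bounds:
  assumes "r \<in> {a..b}" "s \<in> {a..b}" "t \<in> {p..q}"
  shows "L - 3 / 25 \<le> Digamma (n - r - s - t + 1)" "Digamma (n - r - s - t + 1) \<le> L"
proof -
  note u = rest_bounds[OF assms]
  have u_pos: "n - r - s - t > 0" using u(1) n_gt_1 by linarith
  have "- (3 / 25) \<le> ln (9 / 10 :: real)"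
    using ln_one_minus_pos_lower_bound[of "1/10 :: real"] by (simp add: power2_eq_square)
  moreover have "ln (9 / 10 * n) = ln (9 / 10) + L"
    using n_gt_1 by (subst ln_mult_pos) (auto simp: L_def)
  moreover have "ln (9 / 10 * n) \<le> ln (n - r - s - t)"
    using u(1) n_gt_1 u_pos by (subst ln_le_cancel_iff) auto
  ultimately show "L - 3 / 25 \<le> Digamma (n - r - s - t + 1)"
    using ln_le_Digamma_plus1[OF u_pos] by linarith
  have "ln (n - r - s - t + 1) \<le> L"
    unfolding L_def using u(2) n_gt_1 u_pos by (subst ln_le_cancel_iff) auto
  then show "Digamma (n - r - s - t + 1) \<le> L"
    using Digamma_plus1_le_ln[OF u_pos] by linarith
qed

lemma side_log_bounds:
  assumes "x \<in> {a..b}"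
  shows "L - ln (4 * L) \<le> ln x" "ln x \<le> L" "L - ln (4 * L) \<le> Digamma (x + 1)" "Digamma (x + 1) \<le> L"
proof -
  have x: "x > 0" using assms sides_ordered by auto
  have "ln a \<le> ln x" using assms sides_ordered by (subst ln_le_cancel_iff) auto
  then show ln_ge: "L - ln (4 * L) \<le> ln x"
    using n_gt_1 L_gt_3 by (simp add: a_def ln_div L_def)
  then show "L - ln (4 * L) \<le> Digamma (x + 1)"
    using ln_le_Digamma_plus1[OF x] by linarith
  have "ln x \<le> ln (x + 1)" using x by simp
  moreover have ln_le: "ln (x + 1) \<le> L"
    unfolding L_def using assms x b_less by (subst ln_le_cancel_iff) auto
  ultimately show "ln x \<le> L" by linarith
  show "Digamma (x + 1) \<le> L" using Digamma_plus1_le_ln[OF x] ln_le by linarith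
qed

text \<open>\<open>phase_r\<close> and \<open>phase_s\<close> have the common shape of the following two expressions.\<close>

lemma log_derivative_pos_at_left:
  assumes rst: "r \<in> {a..b}" "s \<in> {a..b}" "t \<in> {p..q}" and k: "9 / 10 * n \<le> k"
  shows "- ln r - ln s + k / a - Digamma (a + 1) + Digamma (n - r - s - t + 1) > 0"
proof -
  have "18 / 5 * L \<le> k / a"
    using k n_gt_1 L_gt_3 by (simp add: a_def field_simps)
  moreover have "a \<in> {a..b}" using sides_ordered by simp
  ultimately show ?thesis
    using side_log_bounds(2)[OF rst(1)] side_log_bounds(2)[OF rst(2)] side_log_bounds(4)[of a]
      Digamma_rest_bounds(1)[OF rst] L_gt_3 by linarith
qed

lemma log_derivative_neg_at_right:
  assumes rst: "r \<in> {a..b}" "s \<in> {a..b}" "t \<in> {p..q}" and k: "k \<le> n"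
  shows "- ln r - ln s + k / b - Digamma (b + 1) + Digamma (n - r - s - t + 1) < 0"
proof -
  have "k / b \<le> L"
    using k n_gt_1 L_gt_3 by (simp add: b_def field_simps)
  moreover have "b \<in> {a..b}" using sides_ordered by simp
  ultimately show ?thesis
    using side_log_bounds(1)[OF rst(1)] side_log_bounds(1)[OF rst(2)] side_log_bounds(3)[of b]
      Digamma_rest_bounds(2)[OF rst] ln_4L_less by linarith
qed

lemma phase_t_pos_at_left:
  assumes rst: "r \<in> {a..b}" "s \<in> {a..b}" "p \<in> {p..q}"
  shows "phase_t n r s p > 0"
proof -
  have "ln r \<le> ln b" using rst sides_ordered by (subst ln_le_cancel_iff) auto
  moreover have "ln b = L - ln L" using n_gt_1 L_gt_3 by (simp add: b_def ln_div L_def)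
  moreover have "Digamma (p + 1) \<le> ln (p + 1)" by (rule Digamma_plus1_le_ln) (rule sides_ordered)
  moreover have "ln (p + 1) \<le> ln (5 / 6 * L)"
    using L_gt_3 by (subst ln_le_cancel_iff) (auto simp: p_def)
  moreover have "ln (5 / 6 * L) = ln (5 / 6) + ln L"
    using L_gt_3 by (subst ln_mult_pos) auto
  moreover have "ln (5 / 6 :: real) \<le> - (1 / 6)"
    using ln_le_minus_one[of "5/6 :: real"] by simp
  ultimately show ?thesis using Digamma_rest_bounds(1)[OF rst] unfolding phase_t_def by linarith
qed

lemma phase_t_neg_at_right:
  assumes rst: "r \<in> {a..b}" "s \<in> {a..b}" "q \<in> {p..q}"
  shows "phase_t n r s q < 0"
proof -
  have "ln (4 * L) < ln q" using L_gt_3 by (subst ln_less_cancel_iff) (auto simp: q_def)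
  moreover have "ln q \<le> Digamma (q + 1)" using sides_ordered by (intro ln_le_Digamma_plus1) simp
  ultimately show ?thesis
    using side_log_bounds(1)[OF rst(1)] Digamma_rest_bounds(2)[OF rst]
    unfolding phase_t_def by linarith
qed

lemma phase_attains_max:
  obtains r s t where "r \<in> {a..b}" "s \<in> {a..b}" "t \<in> {p..q}"
    and "\<And>x y z. x \<in> {a..b} \<Longrightarrow> y \<in> {a..b} \<Longrightarrow> z \<in> {p..q} \<Longrightarrow> phase n x y z \<le> phase n r s t"
proof -
  have "2 * b + q < n" using rest_ge n_gt_1 by linarith
  have "compact ({a..b} \<times> ({a..b} \<times> {p..q}))" by (intro compact_Times compact_Icc)
  moreover have "{a..b} \<times> ({a..b} \<times> {p..q}) \<noteq> {}" using sides_ordered by auto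
  moreover have "continuous_on ({a..b} \<times> ({a..b} \<times> {p..q})) (\<lambda>(r, s, t). phase n r s t)"
    unfolding phase_def case_prod_beta
    by (intro continuous_intros continuous_on_compose2[OF continuous_on_ln_Gamma_real])
       (use sides_ordered \<open>2 * b + q < n\<close> in force)+
  ultimately have "\<exists>z\<in>{a..b} \<times> ({a..b} \<times> {p..q}). \<forall>z'\<in>{a..b} \<times> ({a..b} \<times> {p..q}).
      (\<lambda>(r, s, t). phase n r s t) z' \<le> (\<lambda>(r, s, t). phase n r s t) z"
    by (rule continuous_attains_sup)
  then show thesis using that by auto
qed

lemma critical_point_exists:
  "\<exists>r s t. r > 0 \<and> s > 0 \<and> t > 0 \<and> r + s + t < n \<and>
     phase_r n r s t = 0 \<and> phase_s n r s t = 0 \<and> phase_t n r s t = 0"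
proof -
  obtain r s t where rst: "r \<in> {a..b}" "s \<in> {a..b}" "t \<in> {p..q}"
    and max: "\<And>x y z. x \<in> {a..b} \<Longrightarrow> y \<in> {a..b} \<Longrightarrow> z \<in> {p..q} \<Longrightarrow> phase n x y z \<le> phase n r s t"
    using phase_attains_max by blast
  note u = rest_bounds[OF rst]
  have pos: "r > 0" "s > 0" "t > 0" "r + s + t < n"
    using rst sides_ordered u n_gt_1 by auto
  have "phase_r n r s t = 0"
  proof (rule DERIV_zero_at_max_inward[OF rst(1) has_real_derivative_phase(1)[OF pos]])
    show "phase_r n r s t > 0" if "r = a"
      using log_derivative_pos_at_left[OF rst u(1)] that by (simp add: phase_r_def)
    show "phase_r n r s t < 0" if "r = b"
      using log_derivative_neg_at_right[OF rst, of "n - r - s - t"] u(2) that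
      by (simp add: phase_r_def)
  qed (use max rst in auto)
  moreover have "phase_s n r s t = 0"
  proof (rule DERIV_zero_at_max_inward[OF rst(2) has_real_derivative_phase(2)[OF pos]])
    show "phase_s n r s t > 0" if "s = a"
      using log_derivative_pos_at_left[OF rst, of "n - r - s + 1"] u(1) pos that
      by (simp add: phase_s_def)
    show "phase_s n r s t < 0" if "s = b"
      using log_derivative_neg_at_right[OF rst, of "n - r - s + 1"] rst a_ge_1 that
      by (simp add: phase_s_def)
  qed (use max rst in auto)
  moreover have "phase_t n r s t = 0"
  proof (rule DERIV_zero_at_max_inward[OF rst(3) has_real_derivative_phase(3)[OF pos]])
    show "phase_t n r s t > 0" if "t = p"
      using phase_t_pos_at_left[OF rst(1,2)] rst(3) that by simp
    show "phase_t n r s t < 0" if "t = q"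
      using phase_t_neg_at_right[OF rst(1,2)] rst(3) that by simp
  qed (use max rst in auto)
  ultimately show ?thesis using pos by blast
qed

end

lemma eventually_saddle_point_exists: "\<forall>\<^sub>F n in sequentially. \<exists>r s t. saddle_point n r s t"
proof -
  have "\<forall>\<^sub>F n :: nat in sequentially. real n > 1"
    "\<forall>\<^sub>F n :: nat in sequentially. ln (real n) > 3"
    "\<forall>\<^sub>F n :: nat in sequentially. real n / (4 * ln (real n)) \<ge> 1"
    "\<forall>\<^sub>F n :: nat in sequentially. real n / ln (real n) + 1 \<le> real n"
    "\<forall>\<^sub>F n :: nat in sequentially.
      9 / 10 * real n \<le> real n - 2 * (real n / ln (real n)) - 8 * ln (real n)"
    "\<forall>\<^sub>F n :: nat in sequentially. 3 * ln (4 * ln (real n)) + 1 < ln (real n)"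
    by real_asymp+
  then show ?thesis
  proof eventually_elim
    case (elim n)
    then interpret saddle_box "real n" "ln (real n)" "real n / (4 * ln (real n))"
        "real n / ln (real n)" "ln (real n) / 2" "8 * ln (real n)"
      by unfold_locales
    show ?case unfolding saddle_point_iff by (rule critical_point_exists)
  qed
qed

lemma segment_pos:
  fixes v w z :: real
  assumes "v > 0" "w > 0" "0 \<le> z" "z \<le> 1"
  shows "v + z * (w - v) > 0"
  using convexD_alt[OF convex_real_interval(3)[of 0], of v w z] assms by (simp add: algebra_simps)

lemma segment_nonneg:
  fixes v w z :: real
  assumes "v \<ge> 0" "w \<ge> 0" "0 \<le> z" "z \<le> 1"
  shows "v + z * (w - v) \<ge> 0"
  using convexD_alt[OF convex_real_interval(1)[of 0], of v w z] assms by (simp add: algebra_simps)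

lemma segment_le:
  fixes v w z k :: real
  assumes "v \<le> k" "w \<le> k" "0 \<le> z" "z \<le> 1"
  shows "v + z * (w - v) \<le> k"
  using segment_nonneg[of "k - v" "k - w" z] assms by (simp add: algebra_simps)

definition concave_region :: "real \<Rightarrow> real \<Rightarrow> real \<Rightarrow> real \<Rightarrow> bool" where
  "concave_region n r s t \<longleftrightarrow> r > 0 \<and> s > 0 \<and> t > 0 \<and> r \<le> 2 * s \<and> s \<le> 2 * r \<and>
     t + 1 + 2 * r \<le> n - r - s - t \<and> 2 * s \<le> n - r - s"

lemma concave_regionD:
  assumes "concave_region n r s t"
  shows "r > 0" "s > 0" "t > 0" "r + s + t < n"
  using assms unfolding concave_region_def by linarith+

lemma concave_region_segment:
  assumes P: "concave_region n r s t" and Q: "concave_region n r' s' t'" and z: "0 \<le> z" "z \<le> 1"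
  shows "concave_region n (r + z * (r' - r)) (s + z * (s' - s)) (t + z * (t' - t))"
proof -
  have "0 \<le> (2 * s - r) + z * ((2 * s' - r') - (2 * s - r))"
    "0 \<le> (2 * r - s) + z * ((2 * r' - s') - (2 * r - s))"
    "0 \<le> (n - 3 * r - s - 2 * t - 1)
      + z * ((n - 3 * r' - s' - 2 * t' - 1) - (n - 3 * r - s - 2 * t - 1))"
    "0 \<le> (n - r - 3 * s) + z * ((n - r' - 3 * s') - (n - r - 3 * s))"
    using P Q by (intro segment_nonneg z; simp add: concave_region_def)+
  moreover have "0 < r + z * (r' - r)" "0 < s + z * (s' - s)" "0 < t + z * (t' - t)"
    using P Q by (intro segment_pos z; simp add: concave_region_def)+
  ultimately show ?thesis by (simp add: concave_region_def algebra_simps)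
qed

definition phase_slope :: "real \<Rightarrow> real \<Rightarrow> real \<Rightarrow> real \<Rightarrow> real \<Rightarrow> real \<Rightarrow> real \<Rightarrow> real" where
  "phase_slope n r s t a b d = phase_r n r s t * a + phase_s n r s t * b + phase_t n r s t * d"

text \<open>The negated Hessian of \<open>phase\<close> as a quadratic form in \<open>(a, b, d)\<close>.\<close>

definition phase_quad :: "real \<Rightarrow> real \<Rightarrow> real \<Rightarrow> real \<Rightarrow> real \<Rightarrow> real \<Rightarrow> real \<Rightarrow> real" where
  "phase_quad n r s t a b d =
     (Polygamma 1 (r + 1) + 2 / r + (n - r - s - t) / r\<^sup>2) * a\<^sup>2
     + (Polygamma 1 (s + 1) + 2 / s + (n - r - s + 1) / s\<^sup>2) * b\<^sup>2
     + Polygamma 1 (t + 1) * d\<^sup>2 + Polygamma 1 (n - r - s - t + 1) * (a + b + d)\<^sup>2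
     + 2 * a * b * (1 / r + 1 / s) + 2 * a * d / r"

lemma two_mult_le_weighted_squares:
  fixes v w k :: real
  assumes "k > 0"
  shows "- (2 * v * w) \<le> k * v\<^sup>2 + w\<^sup>2 / k"
proof -
  have "0 \<le> (sqrt k * v + w / sqrt k)\<^sup>2" by simp
  also have "\<dots> = k * v\<^sup>2 + w\<^sup>2 / k + 2 * v * w"
    using assms by (simp add: power2_sum power_mult_distrib power_divide)
  finally show ?thesis by simp
qed

lemma sum_weighted_squares_pos:
  fixes a b d :: real
  assumes "k\<^sub>1 > 0" "k\<^sub>2 > 0" "k\<^sub>3 > 0" and "a \<noteq> 0 \<or> b \<noteq> 0 \<or> d \<noteq> 0"
  shows "k\<^sub>1 * a\<^sup>2 + k\<^sub>2 * b\<^sup>2 + k\<^sub>3 * (a + b + d)\<^sup>2 > 0"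
proof (cases "a = 0 \<and> b = 0")
  case True
  then show ?thesis using assms by simp
next
  case False
  then have "k\<^sub>1 * a\<^sup>2 + k\<^sub>2 * b\<^sup>2 > 0"
    using assms by (auto intro: add_pos_nonneg add_nonneg_pos)
  then show ?thesis using assms by (auto intro: add_pos_nonneg)
qed

lemma phase_quad_pos:
  assumes region: "concave_region n r s t" and nz: "a \<noteq> 0 \<or> b \<noteq> 0 \<or> d \<noteq> 0"
  shows "phase_quad n r s t a b d > 0"
proof -
  define u where "u = n - r - s - t"
  have pos: "r > 0" "s > 0" "t > 0" and rs: "r \<le> 2 * s" "s \<le> 2 * r"
    and u: "t + 1 + 2 * r \<le> u" and m: "2 * s \<le> n - r - s"
    using region by (auto simp: concave_region_def u_def)
  have poly_pos: "Polygamma 1 (r + 1) > 0" "Polygamma 1 (s + 1) > 0" "Polygamma 1 (u + 1) > 0"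
    using pos u by (auto intro!: Polygamma1_pos simp del: One_nat_def)
  have cross_ab: "- (2 * a * b * (1 / r + 1 / s)) \<le> 3 / r * a\<^sup>2 + 3 / s * b\<^sup>2"
  proof -
    have "- (2 * a * b) * (1 / r + 1 / s) \<le> (a\<^sup>2 + b\<^sup>2) * (1 / r + 1 / s)"
      using two_mult_le_weighted_squares[of 1 a b] pos by (intro mult_right_mono) auto
    also have "\<dots> = (1 / r + 1 / s) * a\<^sup>2 + (1 / r + 1 / s) * b\<^sup>2" by (simp add: algebra_simps)
    also have "\<dots> \<le> 3 / r * a\<^sup>2 + 3 / s * b\<^sup>2"
      using pos rs by (intro add_mono mult_right_mono) (auto simp: field_simps)
    finally show ?thesis by simp
  qed
  have cross_ad: "- (2 * a * d / r) \<le> (t + 1) / r\<^sup>2 * a\<^sup>2 + Polygamma 1 (t + 1) * d\<^sup>2"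
  proof -
    have "- (2 * (a / r) * d) \<le> (t + 1) * (a / r)\<^sup>2 + d\<^sup>2 / (t + 1)"
      using pos by (intro two_mult_le_weighted_squares) simp
    moreover have "d\<^sup>2 / (t + 1) \<le> Polygamma 1 (t + 1) * d\<^sup>2"
      using mult_right_mono[OF Polygamma1_ge[of "t + 1"], of "d\<^sup>2"] pos by simp
    ultimately show ?thesis by (simp add: power_divide)
  qed
  have diag_a: "((t + 1) / r\<^sup>2 + 3 / r) * a\<^sup>2 \<le> (2 / r + u / r\<^sup>2) * a\<^sup>2"
  proof (intro mult_right_mono)
    have "(t + 1) / r\<^sup>2 + 3 / r = 2 / r + (t + 1 + r) / r\<^sup>2"
      using pos by (simp add: field_simps power2_eq_square)
    also have "\<dots> \<le> 2 / r + u / r\<^sup>2"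
      using pos u by (intro add_left_mono divide_right_mono) auto
    finally show "(t + 1) / r\<^sup>2 + 3 / r \<le> 2 / r + u / r\<^sup>2" .
  qed simp
  have diag_b: "3 / s * b\<^sup>2 \<le> (2 / s + (n - r - s + 1) / s\<^sup>2) * b\<^sup>2"
    using pos m by (intro mult_right_mono) (auto simp: field_simps power2_eq_square)
  show ?thesis
    unfolding phase_quad_def u_def [symmetric]
    using sum_weighted_squares_pos[OF poly_pos nz] cross_ab cross_ad diag_a diag_b
    by (simp add: distrib_right)
qed

lemma has_real_derivative_phase_slope_line:
  fixes n r s t a b d z :: real
  defines "R \<equiv> r + z * a" and "S \<equiv> s + z * b" and "T \<equiv> t + z * d"
  assumes pos: "R > 0" "S > 0" "T > 0" "R + S + T < n"
  shows "((\<lambda>z. phase_slope n (r + z * a) (s + z * b) (t + z * d) a b d)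
    has_real_derivative - phase_quad n R S T a b d) (at z)"
proof -
  have ni: "R + 1 \<notin> \<int>\<^sub>\<le>\<^sub>0" "S + 1 \<notin> \<int>\<^sub>\<le>\<^sub>0" "T + 1 \<notin> \<int>\<^sub>\<le>\<^sub>0" "n - R - S - T + 1 \<notin> \<int>\<^sub>\<le>\<^sub>0"
    using pos by (auto elim!: nonpos_Ints_cases)
  define U' P where "U' = - a - b - d" and "P = Polygamma 1 (n - R - S - T + 1) * U'"
  define D\<^sub>r D\<^sub>s D\<^sub>t where
    "D\<^sub>r = - a / R - b / S + (U' * R - (n - R - S - T) * a) / (R * R) - Polygamma 1 (R + 1) * a + P"
    and "D\<^sub>s = - a / R - b / S + ((- a - b) * S - (n - R - S + 1) * b) / (S * S)
      - Polygamma 1 (S + 1) * b + P"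
    and "D\<^sub>t = - a / R - Polygamma 1 (T + 1) * d + P"
  have "((\<lambda>z. phase_r n (r + z * a) (s + z * b) (t + z * d)) has_real_derivative D\<^sub>r) (at z)"
    "((\<lambda>z. phase_s n (r + z * a) (s + z * b) (t + z * d)) has_real_derivative D\<^sub>s) (at z)"
    "((\<lambda>z. phase_t n (r + z * a) (s + z * b) (t + z * d)) has_real_derivative D\<^sub>t) (at z)"
    unfolding phase_r_def phase_s_def phase_t_def D\<^sub>r_def D\<^sub>s_def D\<^sub>t_def P_def U'_def
    using pos ni unfolding R_def S_def T_def
    by (auto intro!: derivative_eq_intros)
  then have "((\<lambda>z. phase_slope n (r + z * a) (s + z * b) (t + z * d) a b d)
      has_real_derivative D\<^sub>r * a + D\<^sub>s * b + D\<^sub>t * d) (at z)"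
    unfolding phase_slope_def by (intro DERIV_add DERIV_cmult_right)
  moreover have "D\<^sub>r * a + D\<^sub>s * b + D\<^sub>t * d = - phase_quad n R S T a b d"
  proof -
    have "(U' * R - (n - R - S - T) * a) / (R * R) = U' / R - (n - R - S - T) / R\<^sup>2 * a"
      "((- a - b) * S - (n - R - S + 1) * b) / (S * S) = (- a - b) / S - (n - R - S + 1) / S\<^sup>2 * b"
      using pos by (simp_all add: field_simps power2_eq_square)
    then show ?thesis
      unfolding D\<^sub>r_def D\<^sub>s_def D\<^sub>t_def P_def phase_quad_def
      by (simp add: U'_def algebra_simps power2_eq_square add_divide_distrib diff_divide_distrib)
  qed
  ultimately show ?thesis by simp
qed

lemma saddle_point_unique_in_concave_region:
  assumes P: "saddle_point n r s t" "concave_region n r s t"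
    and Q: "saddle_point n r' s' t'" "concave_region n r' s' t'"
  shows "(r', s', t') = (r, s, t)"
proof (rule ccontr)
  define a b d where "a = r' - r" and "b = s' - s" and "d = t' - t"
  assume "(r', s', t') \<noteq> (r, s, t)"
  then have nz: "a \<noteq> 0 \<or> b \<noteq> 0 \<or> d \<noteq> 0" by (auto simp: a_def b_def d_def)
  define slope quad where "slope z = phase_slope n (r + z * a) (s + z * b) (t + z * d) a b d"
    and "quad z = phase_quad n (r + z * a) (s + z * b) (t + z * d) a b d" for z
  have region: "concave_region n (r + z * a) (s + z * b) (t + z * d)" if "0 \<le> z" "z \<le> 1" for z
    using concave_region_segment[OF P(2) Q(2) that] by (simp add: a_def b_def d_def)
  have "(slope has_real_derivative - quad z) (at z)" if "0 \<le> z" "z \<le> 1" for z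
    unfolding slope_def quad_def
    by (intro has_real_derivative_phase_slope_line concave_regionD[OF region[OF that]])
  then obtain z where z: "0 < z" "z < 1" and "slope 1 - slope 0 = (1 - 0) * - quad z"
    using MVT2[OF zero_less_one, of slope "\<lambda>z. - quad z"] by blast
  moreover have "quad z > 0"
    unfolding quad_def using z nz by (intro phase_quad_pos region) auto
  moreover have "slope 0 = 0" "slope 1 = 0"
    using P(1) Q(1) by (simp_all add: slope_def phase_slope_def a_def b_def d_def saddle_point_iff)
  ultimately show False by simp
qed

section \<open>Preliminaries on asymptotic equivalence\<close>

lemma const_smallo_at_top:
  fixes g :: "'a \<Rightarrow> real"
  assumes "filterlim g at_top F"
  shows "(\<lambda>_. k) \<in> o[F](g)"
proof -
  have "(\<lambda>_. 1) \<in> o[F](g)"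
    using filterlim_at_top_imp_at_infinity[OF assms]
    by (simp add: smallomega_iff_smallo [symmetric] smallomega_1_conv_filterlim)
  then show ?thesis by (rule landau_o.big_small_trans[rotated]) simp
qed

lemma asymp_equiv_add_const:
  fixes f g :: "'a \<Rightarrow> real"
  assumes "f \<sim>[F] g" "filterlim g at_top F"
  shows "(\<lambda>x. f x + k) \<sim>[F] g"
  using assms by (simp add: asymp_equiv_add_right const_smallo_at_top)

lemma asymp_equiv_ln:
  fixes f g :: "'a \<Rightarrow> real"
  assumes fg: "f \<sim>[F] g" and g: "filterlim g at_top F"
  shows "(\<lambda>x. ln (f x)) \<sim>[F] (\<lambda>x. ln (g x))"
proof (rule asymp_equivI')
  have g_ev: "\<forall>\<^sub>F x in F. g x > 1" using g by (simp add: filterlim_at_top_dense)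
  have f_ev: "\<forall>\<^sub>F x in F. f x > 1"
    using asymp_equiv_at_top_transfer[OF asymp_equiv_symI[OF fg] g]
    by (simp add: filterlim_at_top_dense)
  have "\<forall>\<^sub>F x in F. f x \<noteq> 0 \<or> g x \<noteq> 0" using g_ev by eventually_elim auto
  then have "((\<lambda>x. f x / g x) \<longlongrightarrow> 1) F" by (rule asymp_equivD_strong[OF fg])
  then have "((\<lambda>x. ln (f x / g x)) \<longlongrightarrow> ln 1) F" by (intro tendsto_intros) auto
  then have "((\<lambda>x. ln (f x / g x) / ln (g x)) \<longlongrightarrow> 0) F"
    by (rule tendsto_divide_0)
       (intro filterlim_at_top_imp_at_infinity filterlim_compose[OF ln_at_top g])
  then have "((\<lambda>x. ln (f x / g x) / ln (g x) + 1) \<longlongrightarrow> 0 + 1) F" by (intro tendsto_intros)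
  moreover have "\<forall>\<^sub>F x in F. ln (f x / g x) / ln (g x) + 1 = ln (f x) / ln (g x)"
    using f_ev g_ev by eventually_elim (simp add: ln_div diff_divide_distrib)
  ultimately show "((\<lambda>x. ln (f x) / ln (g x)) \<longlongrightarrow> 1) F"
    by (simp add: tendsto_cong)
qed

section \<open>Location of the saddle points\<close>

definition exp_Digamma :: "real \<Rightarrow> real" where
  "exp_Digamma x = exp (Digamma (x + 1))"

lemma exp_Digamma_bounds:
  assumes "x > 0"
  shows exp_Digamma_ge: "x + 1 / 2 \<le> exp_Digamma x"
    and exp_Digamma_le: "exp_Digamma x \<le> x + 1"
    and exp_Digamma_le_mult_exp: "exp_Digamma x \<le> x * exp (1 / (2 * x))"
proof -
  have "exp (ln (x + 1 / 2)) \<le> exp_Digamma x" "exp_Digamma x \<le> exp (ln (x + 1))"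
    "exp_Digamma x \<le> exp (ln x + 1 / (2 * x))"
    using Digamma_plus1_bounds[OF assms] unfolding exp_Digamma_def exp_le_cancel_iff by blast+
  then show "x + 1 / 2 \<le> exp_Digamma x" "exp_Digamma x \<le> x + 1"
    "exp_Digamma x \<le> x * exp (1 / (2 * x))"
    using assms by (simp_all add: exp_add)
qed

lemma exp_Digamma_minus_tendsto: "((\<lambda>x. exp_Digamma x - x) \<longlongrightarrow> 1 / 2) at_top"
proof (rule tendsto_sandwich)
  show "\<forall>\<^sub>F x in at_top. 1 / 2 \<le> exp_Digamma x - x"
    using eventually_gt_at_top[of 0]
    by eventually_elim (use exp_Digamma_ge in \<open>auto simp: algebra_simps\<close>)
  show "\<forall>\<^sub>F x in at_top. exp_Digamma x - x \<le> x * exp (1 / (2 * x)) - x"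
    using eventually_gt_at_top[of 0] by eventually_elim (use exp_Digamma_le_mult_exp in auto)
  show "((\<lambda>x :: real. x * exp (1 / (2 * x)) - x) \<longlongrightarrow> 1 / 2) at_top" by real_asymp
qed simp

context
  fixes n :: nat and r s t u \<tau> :: real
  assumes saddle: "saddle_point n r s t"
  defines "u \<equiv> real n - r - s - t" and "\<tau> \<equiv> exp_Digamma t"
begin

lemma saddle_point_pos: "r > 0" "s > 0" "t > 0" "u > 0" "\<tau> > 0"
  using saddle by (simp_all add: saddle_point_iff u_def \<tau>_def exp_Digamma_def)

lemma saddle_point_exp_Digamma: "exp_Digamma u = r * \<tau>"
proof -
  have "Digamma (u + 1) = ln r + Digamma (t + 1)"
    using saddle by (simp add: saddle_point_iff phase_t_def u_def)
  then show ?thesis using saddle_point_pos by (simp add: exp_Digamma_def \<tau>_def exp_add)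
qed

lemma saddle_point_u_bounds: "r * \<tau> - 1 \<le> u" "u \<le> r * \<tau> - 1 / 2"
  using exp_Digamma_le[OF saddle_point_pos(4)] exp_Digamma_ge[OF saddle_point_pos(4)]
    saddle_point_exp_Digamma
  by linarith+

lemma saddle_point_t_bounds: "t + 1 / 2 \<le> \<tau>" "\<tau> \<le> t + 1"
  unfolding \<tau>_def by (intro exp_Digamma_bounds saddle_point_pos)+

lemma saddle_point_log_equations:
  shows "u / r + ln \<tau> = ln s + Digamma (r + 1)"
    and "(t + u + 1) / s + ln \<tau> = ln s + Digamma (s + 1)"
proof -
  have "ln r + ln \<tau> = Digamma (u + 1)"
    using arg_cong[OF saddle_point_exp_Digamma, of ln] saddle_point_pos
    by (simp add: exp_Digamma_def ln_mult_pos)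
  moreover have "- ln r - ln s + u / r - Digamma (r + 1) + Digamma (u + 1) = 0"
    "- ln r - ln s + (t + u + 1) / s - Digamma (s + 1) + Digamma (u + 1) = 0"
    using saddle by (simp_all add: saddle_point_iff phase_r_def phase_s_def u_def)
  ultimately show "u / r + ln \<tau> = ln s + Digamma (r + 1)"
    and "(t + u + 1) / s + ln \<tau> = ln s + Digamma (s + 1)"
    by linarith+
qed

lemma saddle_point_quotients_diff:
  "(t + u + 1) / s - u / r = Digamma (s + 1) - Digamma (r + 1)"
  using saddle_point_log_equations by linarith

lemma saddle_point_r_less_s: "r < s"
proof (rule ccontr)
  assume "\<not> r < s"
  then have "Digamma (s + 1) \<le> Digamma (r + 1)"
    using saddle_point_pos by (intro Digamma_real_mono) auto
  then have "(t + u + 1) / s \<le> u / r" using saddle_point_quotients_diff by linarith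
  also have "\<dots> \<le> u / s"
    using \<open>\<not> r < s\<close> saddle_point_pos by (intro divide_left_mono) auto
  also have "\<dots> < (t + u + 1) / s"
    using saddle_point_pos by (intro divide_strict_right_mono) auto
  finally show False by simp
qed

lemma saddle_point_s_le:
  assumes "r \<ge> 4"
  shows "s \<le> r + 4"
proof -
  have "r * (t + 1) / 4 + (r * t / 2 + r * (t + 1) / 4) = r * (t + 1 / 2)"
    by (simp add: field_simps)
  moreover have "r * (t + 1) / 4 \<ge> 1" using assms saddle_point_pos mult_mono[of 4 r 1 "t + 1"]
    by simp
  moreover have "r * t / 2 \<ge> 0" using saddle_point_pos by simp
  moreover have "r * (t + 1 / 2) \<le> r * \<tau>"
    using saddle_point_pos saddle_point_t_bounds by (intro mult_left_mono) auto
  ultimately have "r * (t + 1) / 4 \<le> u" using saddle_point_u_bounds by linarith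
  have "Digamma (r + 1) \<le> Digamma (s + 1)"
    using saddle_point_pos saddle_point_r_less_s by (intro Digamma_real_mono) auto
  then have "u / r \<le> (t + u + 1) / s" using saddle_point_quotients_diff by linarith
  then have "u * s \<le> u * r + r * (t + 1)" using saddle_point_pos by (simp add: field_simps)
  also have "\<dots> \<le> u * (r + 4)" using \<open>r * (t + 1) / 4 \<le> u\<close> by (simp add: algebra_simps)
  finally show ?thesis using saddle_point_pos by simp
qed

lemma saddle_point_ln_r_le: "ln r \<le> \<tau>"
proof -
  have "u / r \<le> \<tau>" using saddle_point_u_bounds saddle_point_pos by (simp add: field_simps)
  moreover have "ln \<tau> \<le> \<tau>" using ln_le_minus_one[of \<tau>] saddle_point_pos by linarith
  moreover have "ln r \<le> ln s" using saddle_point_r_less_s saddle_point_pos by simp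
  ultimately show ?thesis
    using saddle_point_log_equations(1) ln_le_Digamma_plus1[OF saddle_point_pos(1)] by linarith
qed

lemma saddle_point_n_le: "real n \<le> 2 * s + (s + 1) * (s * (s + 1))"
proof -
  have "(t + u + 1) / s > 0" using saddle_point_pos by simp
  then have "ln \<tau> \<le> ln s + ln (s + 1)"
    using saddle_point_log_equations(2) Digamma_plus1_le_ln[OF saddle_point_pos(2)] by linarith
  then have \<tau>: "\<tau> \<le> s * (s + 1)"
    using saddle_point_pos by (simp add: ln_mult_pos [symmetric])
  then have "r * \<tau> \<le> s * (s * (s + 1))"
    using saddle_point_pos saddle_point_r_less_s by (intro mult_mono) auto
  moreover have "(s + 1) * (s * (s + 1)) = s * (s * (s + 1)) + s * (s + 1)"
    by (simp add: algebra_simps)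
  moreover have "real n = r + s + t + u" by (simp add: u_def)
  ultimately show ?thesis
    using \<tau> saddle_point_u_bounds saddle_point_t_bounds saddle_point_r_less_s by linarith
qed

lemma saddle_point_ln_s_le:
  assumes "s \<ge> 1"
  shows "ln s \<le> (r + 1)\<^sup>2 + 1 + ln (r + 1)"
proof -
  have "u / r > 0" using saddle_point_pos by simp
  then have ln_\<tau>: "ln \<tau> \<le> ln s + ln (r + 1)"
    using saddle_point_log_equations(1) Digamma_plus1_le_ln[OF saddle_point_pos(1)] by linarith
  then have "\<tau> \<le> s * (r + 1)"
    using saddle_point_pos by (simp add: ln_mult_pos [symmetric])
  then have "(r + 1) * \<tau> \<le> (r + 1) * (s * (r + 1))"
    using saddle_point_pos by (intro mult_left_mono) auto
  then have "t + u + 1 \<le> (r + 1)\<^sup>2 * s + s"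
    using saddle_point_u_bounds saddle_point_t_bounds assms
    by (simp add: algebra_simps power2_eq_square)
  then have "(t + u + 1) / s \<le> (r + 1)\<^sup>2 + 1"
    using saddle_point_pos by (simp add: field_simps)
  then show ?thesis
    using ln_\<tau> saddle_point_log_equations(2) ln_le_Digamma_plus1[OF saddle_point_pos(2)] by linarith
qed

lemma saddle_point_in_concave_region:
  assumes "r \<ge> 4" "t \<ge> 4"
  shows "concave_region n r s t"
proof -
  have "r * (t + 1 / 2) \<le> r * \<tau>"
    using saddle_point_pos saddle_point_t_bounds by (intro mult_left_mono) auto
  moreover have "(r - 1) * (t - 4) \<ge> 0" using assms by (intro mult_nonneg_nonneg) auto
  then have "r * (t + 1 / 2) \<ge> t + 9 / 2 * r - 4" by (simp add: algebra_simps)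
  ultimately have u: "t + 1 + 2 * r \<le> u" using saddle_point_u_bounds assms by linarith
  then have "2 * s \<le> t + u" using saddle_point_s_le assms by linarith
  then show ?thesis
    using u assms saddle_point_pos saddle_point_r_less_s saddle_point_s_le
    by (auto simp: concave_region_def u_def)
qed

end

lemma eventually_saddle_points_ge:
  "\<forall>\<^sub>F n in sequentially. \<forall>r s t. saddle_point n r s t \<longrightarrow> R \<le> r \<and> R \<le> s \<and> R \<le> t"
proof -
  define R\<^sub>r where "R\<^sub>r = max R (exp (R + 1))"
  define R\<^sub>s where "R\<^sub>s = exp ((R\<^sub>r + 1)\<^sup>2 + 1 + ln (R\<^sub>r + 1))"
  have "R\<^sub>r > 0" by (simp add: R\<^sub>r_def less_max_iff_disj)
  have "R\<^sub>s \<ge> 1" using \<open>R\<^sub>r > 0\<close> by (simp add: R\<^sub>s_def)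
  have "\<forall>\<^sub>F n :: nat in sequentially. real n > 2 * R\<^sub>s + (R\<^sub>s + 1) * (R\<^sub>s * (R\<^sub>s + 1))"
    using filterlim_real_sequentially by (simp add: filterlim_at_top_dense)
  then show ?thesis
  proof (eventually_elim, intro allI impI)
    fix n r s t
    assume n: "real n > 2 * R\<^sub>s + (R\<^sub>s + 1) * (R\<^sub>s * (R\<^sub>s + 1))" and sp: "saddle_point n r s t"
    note pos = saddle_point_pos[OF sp]
    have "s > R\<^sub>s"
    proof (rule ccontr)
      assume "\<not> s > R\<^sub>s"
      then have "2 * s + (s + 1) * (s * (s + 1)) \<le> 2 * R\<^sub>s + (R\<^sub>s + 1) * (R\<^sub>s * (R\<^sub>s + 1))"
        using pos by (intro add_mono mult_mono) auto
      then show False using n saddle_point_n_le[OF sp] by linarith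
    qed
    have "r > R\<^sub>r"
    proof (rule ccontr)
      assume "\<not> r > R\<^sub>r"
      then have "(r + 1)\<^sup>2 + 1 + ln (r + 1) \<le> (R\<^sub>r + 1)\<^sup>2 + 1 + ln (R\<^sub>r + 1)"
        using pos by (intro add_mono power_mono) auto
      moreover have "ln R\<^sub>s < ln s" using \<open>s > R\<^sub>s\<close> \<open>R\<^sub>s \<ge> 1\<close> by simp
      ultimately show False
        using saddle_point_ln_s_le[OF sp] \<open>s > R\<^sub>s\<close> \<open>R\<^sub>s \<ge> 1\<close> by (simp add: R\<^sub>s_def)
    qed
    then have "ln (exp (R + 1)) \<le> ln r" using pos by (subst ln_le_cancel_iff) (auto simp: R\<^sub>r_def)
    then have "R \<le> t" using saddle_point_ln_r_le[OF sp] saddle_point_t_bounds[OF sp] by simp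
    then show "R \<le> r \<and> R \<le> s \<and> R \<le> t"
      using \<open>r > R\<^sub>r\<close> saddle_point_r_less_s[OF sp] by (auto simp: R\<^sub>r_def)
  qed
qed

lemma eventually_saddle_point_ex1: "\<forall>\<^sub>F n in sequentially. \<exists>!(r, s, t). saddle_point n r s t"
  using eventually_saddle_point_exists eventually_saddle_points_ge[of 4]
proof eventually_elim
  case (elim n)
  then obtain r s t where sp: "saddle_point n r s t" by blast
  show ?case
  proof (rule ex1I[of _ "(r, s, t)"])
    show "case (r, s, t) of (r, s, t) \<Rightarrow> saddle_point n r s t" using sp by simp
    fix x assume "case x of (r, s, t) \<Rightarrow> saddle_point n r s t"
    then obtain r' s' t' where x: "x = (r', s', t')" and sp': "saddle_point n r' s' t'"
      by (cases x) auto
    have "(r', s', t') = (r, s, t)"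
      using sp sp' elim(2)
      by (intro saddle_point_unique_in_concave_region saddle_point_in_concave_region) auto
    then show "x = (r, s, t)" by (simp add: x)
  qed
qed

definition centre :: "nat \<Rightarrow> real" where
  "centre n = real n / (2 * ln (real n))"

lemma centre_at_top: "filterlim centre at_top sequentially"
  unfolding centre_def [abs_def] by real_asymp

lemma centre_smallo: "centre \<in> o(real)"
  unfolding centre_def [abs_def] by real_asymp

lemma centre_pos:
  assumes "n \<ge> 2"
  shows "centre n > 0"
  using assms by (simp add: centre_def)

lemma centre_bounds:
  assumes "ln (real n) \<ge> 17"
  shows "n \<ge> 2" "1 \<le> centre n" "34 * centre n \<le> real n"
proof -
  show "n \<ge> 2" using assms by (cases n rule: nat.exhaust, simp, cases "n = 1") auto
  then have "real n > 0" by simp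
  then have "ln (real n / 2) \<le> real n / 2 - 1" by (intro ln_le_minus_one) simp
  moreover have "ln (real n / 2) = ln (real n) - ln 2" using \<open>real n > 0\<close> by (simp add: ln_div)
  moreover have "ln 2 \<le> (1 :: real)" using ln_le_minus_one[of "2 :: real"] by simp
  ultimately have "2 * ln (real n) \<le> real n" by linarith
  then show "1 \<le> centre n" using assms by (simp add: centre_def field_simps)
  have "real n * 17 \<le> real n * ln (real n)" using assms by (intro mult_left_mono) auto
  then show "34 * centre n \<le> real n" using assms by (simp add: centre_def field_simps)
qed

lemma eventually_le_centre:
  fixes f :: "nat \<Rightarrow> real"
  assumes f: "f \<sim>[sequentially] centre"
  shows "\<forall>\<^sub>F n in sequentially. 1 \<le> f n \<and> f n \<le> 2 * centre n"
proof -
  have "filterlim f at_top sequentially"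
    by (rule asymp_equiv_at_top_transfer[OF asymp_equiv_symI[OF f] centre_at_top])
  then have "\<forall>\<^sub>F n in sequentially. 1 \<le> f n" by (simp add: filterlim_at_top)
  moreover have "\<forall>\<^sub>F n in sequentially. norm (f n) \<le> 2 * norm (centre n)"
    using f by (rule asymp_equiv_imp_eventually_le) simp
  ultimately show ?thesis
    using eventually_ge_at_top[of 2] by eventually_elim (use centre_pos in fastforce)
qed

locale saddle_sequence =
  fixes r s t :: "nat \<Rightarrow> real"
  assumes saddle: "\<forall>\<^sub>F n in sequentially. saddle_point n (r n) (s n) (t n)"
begin

definition m where "m n = real n - r n - s n"
definition u where "u n = real n - r n - s n - t n"
definition \<tau> where "\<tau> n = exp_Digamma (t n)"

lemma eventually_saddle_ge: "\<forall>\<^sub>F n in sequentially. R \<le> r n \<and> R \<le> s n \<and> R \<le> t n"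
  using saddle eventually_saddle_points_ge[of R] by eventually_elim blast

lemma r_at_top: "filterlim r at_top sequentially"
  and s_at_top: "filterlim s at_top sequentially"
  and t_at_top: "filterlim t at_top sequentially"
  by (auto simp: filterlim_at_top intro: eventually_mono[OF eventually_saddle_ge])

lemma eventually_saddle_bounds:
  "\<forall>\<^sub>F n in sequentially. 4 \<le> r n \<and> r n < s n \<and> s n \<le> r n + 4 \<and> 4 \<le> t n \<and>
     t n + 1 / 2 \<le> \<tau> n \<and> \<tau> n \<le> t n + 1 \<and> r n * \<tau> n - 1 \<le> u n \<and> u n \<le> r n * \<tau> n - 1 / 2 \<and>
     ln (r n) \<le> \<tau> n \<and> u n / r n + ln (\<tau> n) = ln (s n) + Digamma (r n + 1)"
  using saddle eventually_saddle_ge[of 4]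
proof eventually_elim
  case (elim n)
  then have "4 \<le> r n" "4 \<le> t n" by blast+
  then show ?case
    unfolding \<tau>_def u_def
    by (intro conjI saddle_point_r_less_s[OF elim(1)] saddle_point_s_le[OF elim(1)]
        saddle_point_t_bounds[OF elim(1)] saddle_point_u_bounds[OF elim(1)]
        saddle_point_ln_r_le[OF elim(1)] saddle_point_log_equations(1)[OF elim(1)])
qed

lemma tau_at_top: "filterlim \<tau> at_top sequentially"
  by (rule filterlim_at_top_mono[OF t_at_top])
     (use eventually_saddle_bounds in eventually_elim, linarith)

lemma u_at_top: "filterlim u at_top sequentially"
proof (rule filterlim_at_top_mono)
  show "filterlim (\<lambda>n. - 1 + r n * \<tau> n) at_top sequentially"
    by (intro filterlim_tendsto_add_at_top[OF tendsto_const] filterlim_at_top_mult_at_top r_at_top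
        tau_at_top)
qed (use eventually_saddle_bounds in eventually_elim, linarith)

lemma s_asymp_equiv_r: "s \<sim>[sequentially] r"
proof (rule asymp_equiv_sandwich_real)
  show "\<forall>\<^sub>F n in sequentially. s n \<in> {r n..r n + 4}"
    using eventually_saddle_bounds by eventually_elim auto
  show "(\<lambda>n. r n + 4) \<sim>[sequentially] r"
    by (rule asymp_equiv_add_const[OF asymp_equiv_refl r_at_top])
qed simp

lemma tau_asymp_equiv_ln_r: "\<tau> \<sim>[sequentially] (\<lambda>n. 2 * ln (r n))"
proof -
  have "(\<lambda>n. \<tau> n + ln (\<tau> n)) \<sim>[sequentially] (\<lambda>n. 2 * ln (r n))"
  proof (rule asymp_equiv_sandwich_real)
    show "\<forall>\<^sub>F n in sequentially. \<tau> n + ln (\<tau> n) \<in> {2 * ln (r n)..ln (r n + 4) + ln (r n + 1) + 1}"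
      using eventually_saddle_bounds
    proof eventually_elim
      case (elim n)
      have "\<tau> n - 1 \<le> u n / r n" "u n / r n \<le> \<tau> n" using elim by (simp_all add: field_simps)
      moreover have "ln (r n) \<le> ln (s n)" "ln (s n) \<le> ln (r n + 4)" using elim by simp_all
      moreover have "ln (r n) \<le> Digamma (r n + 1)" "Digamma (r n + 1) \<le> ln (r n + 1)"
        using elim by (intro Digamma_plus1_bounds; simp)+
      ultimately show ?case using elim unfolding atLeastAtMost_iff by linarith
    qed
    show "(\<lambda>n. ln (r n + 4) + ln (r n + 1) + 1) \<sim>[sequentially] (\<lambda>n. 2 * ln (r n))"
      by (rule asymp_equiv_compose'[OF _ r_at_top]) real_asymp
  qed simp
  moreover have "\<tau> \<sim>[sequentially] (\<lambda>n. \<tau> n + ln (\<tau> n))"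
    by (rule asymp_equiv_compose'[OF _ tau_at_top, of "\<lambda>x. x", simplified]) real_asymp
  ultimately show ?thesis by (rule asymp_equiv_trans[rotated])
qed

lemma n_asymp_equiv_r_tau: "real \<sim>[sequentially] (\<lambda>n. r n * \<tau> n)"
proof (rule smallo_imp_asymp_equiv)
  have "r \<in> o(\<lambda>n. r n * \<tau> n)" "\<tau> \<in> o(\<lambda>n. r n * \<tau> n)"
    using landau_o.small.mult_left[OF const_smallo_at_top[OF tau_at_top, of 1], of r]
      landau_o.small.mult_right[OF const_smallo_at_top[OF r_at_top, of 1], of \<tau>] by simp_all
  then have "(\<lambda>n. 3 * r n + \<tau> n) \<in> o(\<lambda>n. r n * \<tau> n)" by (intro sum_in_smallo) simp_all
  moreover have "(\<lambda>n. real n - r n * \<tau> n) \<in> O(\<lambda>n. 3 * r n + \<tau> n)"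
  proof (rule bigoI[where c = 1])
    show "\<forall>\<^sub>F n in sequentially. norm (real n - r n * \<tau> n) \<le> 1 * norm (3 * r n + \<tau> n)"
      using eventually_saddle_bounds
    proof eventually_elim
      case (elim n)
      have "real n = r n + s n + t n + u n" by (simp add: u_def)
      then show ?case using elim by auto
    qed
  qed
  ultimately show "(\<lambda>n. real n - r n * \<tau> n) \<in> o(\<lambda>n. r n * \<tau> n)"
    by (rule landau_o.big_small_trans[rotated])
qed

lemma ln_n_asymp_equiv_ln_r: "(\<lambda>n. ln (real n)) \<sim>[sequentially] (\<lambda>n. ln (r n))"
proof -
  have "real \<sim>[sequentially] (\<lambda>n. r n * (2 * ln (r n)))"
    by (rule asymp_equiv_trans[OF n_asymp_equiv_r_tau])
       (intro asymp_equiv_intros tau_asymp_equiv_ln_r)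
  moreover have "filterlim (\<lambda>n. r n * (2 * ln (r n))) at_top sequentially"
    by (rule filterlim_compose[OF _ r_at_top]) real_asymp
  ultimately have "(\<lambda>n. ln (real n)) \<sim>[sequentially] (\<lambda>n. ln (r n * (2 * ln (r n))))"
    by (rule asymp_equiv_ln)
  also have "\<dots> \<sim>[sequentially] (\<lambda>n. ln (r n))"
    by (rule asymp_equiv_compose'[OF _ r_at_top]) real_asymp
  finally show ?thesis .
qed

lemma tau_asymp_equiv: "\<tau> \<sim>[sequentially] (\<lambda>n. 2 * ln (real n))"
  by (rule asymp_equiv_trans[OF tau_asymp_equiv_ln_r])
     (intro asymp_equiv_intros asymp_equiv_symI[OF ln_n_asymp_equiv_ln_r])

lemma t_asymp_equiv: "t \<sim>[sequentially] (\<lambda>n. 2 * ln (real n))"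
proof -
  have "t \<sim>[sequentially] \<tau>"
  proof (rule asymp_equiv_sandwich_real')
    show "\<forall>\<^sub>F n in sequentially. \<tau> n \<in> {t n..t n + 1}"
      using eventually_saddle_bounds by eventually_elim auto
    show "t \<sim>[sequentially] (\<lambda>n. t n + 1)"
      by (rule asymp_equiv_symI[OF asymp_equiv_add_const[OF asymp_equiv_refl t_at_top]])
  qed simp
  then show ?thesis using tau_asymp_equiv by (rule asymp_equiv_trans)
qed

lemma r_asymp_equiv: "r \<sim>[sequentially] centre"
proof -
  have "(\<lambda>n. r n * \<tau> n / \<tau> n) \<sim>[sequentially] centre"
    unfolding centre_def [abs_def]
    by (intro asymp_equiv_intros tau_asymp_equiv asymp_equiv_symI[OF n_asymp_equiv_r_tau])
  moreover have "\<forall>\<^sub>F n in sequentially. r n * \<tau> n / \<tau> n = r n"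
    using eventually_saddle_bounds by eventually_elim simp
  ultimately show ?thesis by (rule asymp_equiv_transfer) simp
qed

lemma s_asymp_equiv: "s \<sim>[sequentially] centre"
  using s_asymp_equiv_r r_asymp_equiv by (rule asymp_equiv_trans)

lemma u_asymp_equiv: "u \<sim>[sequentially] real"
proof -
  have "u \<sim>[sequentially] (\<lambda>n. r n * \<tau> n)"
  proof (rule asymp_equiv_sandwich_real)
    show "\<forall>\<^sub>F n in sequentially. u n \<in> {r n * \<tau> n + - 1..r n * \<tau> n}"
      using eventually_saddle_bounds by eventually_elim auto
    show "(\<lambda>n. r n * \<tau> n + - 1) \<sim>[sequentially] (\<lambda>n. r n * \<tau> n)"
      by (intro asymp_equiv_add_const asymp_equiv_refl filterlim_at_top_mult_at_top r_at_top
          tau_at_top)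
  qed simp
  also have "\<dots> \<sim>[sequentially] real" by (rule asymp_equiv_symI[OF n_asymp_equiv_r_tau])
  finally show ?thesis .
qed

lemma m_eq: "m n = t n + u n"
  by (simp add: m_def u_def)

lemma m_asymp_equiv: "m \<sim>[sequentially] real"
proof (rule asymp_equiv_sandwich_real)
  show "\<forall>\<^sub>F n in sequentially. m n \<in> {u n..real n}"
    using eventually_saddle_bounds by eventually_elim (simp add: m_def u_def)
qed (use u_asymp_equiv in simp_all)

lemma t_over_r_tendsto: "(\<lambda>n. t n / r n) \<longlonglongrightarrow> 0"
proof -
  have "(\<lambda>n. t n / r n) \<sim>[sequentially] (\<lambda>n. 2 * ln (real n) / centre n)"
    by (intro asymp_equiv_intros t_asymp_equiv r_asymp_equiv)
  moreover have "(\<lambda>n. 2 * ln (real n) / centre n) \<longlonglongrightarrow> 0"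
    unfolding centre_def by real_asymp
  ultimately show ?thesis by (simp only: tendsto_asymp_equiv_cong)
qed

lemma m_over_r_minus_t_tendsto: "(\<lambda>n. m n / r n - t n) \<longlonglongrightarrow> 1 / 2"
proof -
  have "(\<lambda>n. (exp_Digamma (u n) - u n) / r n) \<longlonglongrightarrow> 0"
    by (rule tendsto_divide_0[OF filterlim_compose[OF exp_Digamma_minus_tendsto u_at_top]])
       (rule filterlim_at_top_imp_at_infinity[OF r_at_top])
  then have "(\<lambda>n. \<tau> n - t n - (exp_Digamma (u n) - u n) / r n + t n / r n) \<longlonglongrightarrow> 1 / 2 - 0 + 0"
    unfolding \<tau>_def
    by (intro tendsto_intros t_over_r_tendsto
        filterlim_compose[OF exp_Digamma_minus_tendsto t_at_top])
  moreover have "\<forall>\<^sub>F n in sequentially.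
      \<tau> n - t n - (exp_Digamma (u n) - u n) / r n + t n / r n = m n / r n - t n"
    using saddle
  proof eventually_elim
    case (elim n)
    have "exp_Digamma (u n) = r n * \<tau> n" "r n > 0"
      using saddle_point_exp_Digamma[OF elim] saddle_point_pos[OF elim]
      by (simp_all add: u_def \<tau>_def)
    then show ?case by (simp add: m_eq field_simps)
  qed
  ultimately show ?thesis by (simp add: tendsto_cong)
qed

end

section \<open>Lattice sums converging to an integral\<close>

lemma has_bochner_integral_gaussian:
  fixes a :: real
  assumes "a > 0"
  shows "has_bochner_integral lborel (\<lambda>x. exp (- a * x\<^sup>2)) (sqrt (pi / a))"
proof -
  define \<sigma> where "\<sigma> = 1 / sqrt (2 * a)"
  have "\<sigma> > 0" and \<sigma>: "\<sigma>\<^sup>2 = 1 / (2 * a)"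
    using assms by (simp_all add: \<sigma>_def power_divide)
  have density: "exp (- a * x\<^sup>2) = sqrt (pi / a) * normal_density 0 \<sigma> x" for x
    using assms by (simp add: normal_density_def \<sigma>)
  show ?thesis
    unfolding density has_bochner_integral_iff using \<open>\<sigma> > 0\<close> by simp
qed

lemma has_bochner_integral_gaussian_pair:
  fixes a :: real
  assumes "a > 0"
  shows "has_bochner_integral (lborel \<Otimes>\<^sub>M lborel) (\<lambda>(x, y). exp (- a * (x\<^sup>2 + y\<^sup>2))) (pi / a)"
proof -
  note gauss = has_bochner_integral_gaussian[OF assms, unfolded has_bochner_integral_iff]
  have split: "exp (- a * (x\<^sup>2 + y\<^sup>2)) = exp (- a * x\<^sup>2) * exp (- a * y\<^sup>2)" for x y :: real
    by (simp add: exp_add [symmetric] algebra_simps)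
  have integrable: "integrable (lborel \<Otimes>\<^sub>M lborel)
      (\<lambda>(x, y). exp (- a * x\<^sup>2) * exp (- a * y\<^sup>2) :: real)"
  proof (rule lborel_pair.Fubini_integrable)
    show "integrable lborel (\<lambda>x. LINT y|lborel.
        norm (case (x, y) of (x, y) \<Rightarrow> exp (- a * x\<^sup>2) * exp (- a * y\<^sup>2)))"
      using gauss by (simp add: abs_mult)
  qed (use gauss in \<open>simp_all, measurable\<close>)
  have "(\<integral>z. (case z of (x, y) \<Rightarrow> exp (- a * x\<^sup>2) * exp (- a * y\<^sup>2)) \<partial>(lborel \<Otimes>\<^sub>M lborel)) =
      (\<integral>x. (\<integral>y. exp (- a * x\<^sup>2) * exp (- a * y\<^sup>2) \<partial>lborel) \<partial>lborel)"
    by (subst lborel_pair.integral_fst'[OF integrable, symmetric]) simp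
  also have "\<dots> = sqrt (pi / a) * sqrt (pi / a)" using gauss by simp
  finally show ?thesis
    unfolding split has_bochner_integral_iff using integrable assms by simp
qed

definition lattice_cell :: "real \<Rightarrow> real \<Rightarrow> nat \<Rightarrow> real set" where
  "lattice_cell p \<sigma> i = {(real i - p) / \<sigma>..<(real i + 1 - p) / \<sigma>}"

definition lattice_index :: "real \<Rightarrow> real \<Rightarrow> real \<Rightarrow> nat" where
  "lattice_index p \<sigma> x = nat \<lfloor>p + \<sigma> * x\<rfloor>"

lemma mem_lattice_cell_iff:
  assumes "\<sigma> > 0"
  shows "x \<in> lattice_cell p \<sigma> i \<longleftrightarrow> 0 \<le> p + \<sigma> * x \<and> i = lattice_index p \<sigma> x"
proof -
  have "x \<in> lattice_cell p \<sigma> i \<longleftrightarrow> real i \<le> p + \<sigma> * x \<and> p + \<sigma> * x < real i + 1"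
    using assms by (auto simp: lattice_cell_def field_simps)
  also have "\<dots> \<longleftrightarrow> \<lfloor>p + \<sigma> * x\<rfloor> = int i"
    by (auto simp: floor_eq_iff)
  also have "\<dots> \<longleftrightarrow> 0 \<le> p + \<sigma> * x \<and> i = lattice_index p \<sigma> x"
    unfolding lattice_index_def by (metis nat_0_le nat_int of_nat_0_le_iff zero_le_floor)
  finally show ?thesis .
qed

lemma lattice_cell_dist_le:
  assumes "x \<in> lattice_cell p \<sigma> i"
  shows "\<bar>(real i - p) / \<sigma> - x\<bar> \<le> 1 / \<sigma>"
  using assms by (auto simp: lattice_cell_def add_divide_distrib diff_divide_distrib)

lemma emeasure_lattice_cell:
  assumes "\<sigma> > 0"
  shows "emeasure lborel (lattice_cell p \<sigma> i) = ennreal (1 / \<sigma>)"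
proof -
  have "(real i - p) / \<sigma> \<le> (real i + 1 - p) / \<sigma>" using assms by (intro divide_right_mono) auto
  then show ?thesis
    unfolding lattice_cell_def by (simp add: diff_divide_distrib add_divide_distrib)
qed

lemma lattice_cell_sets [measurable]: "lattice_cell p \<sigma> i \<in> sets borel"
  by (simp add: lattice_cell_def)

lemma has_bochner_integral_lattice_cell:
  assumes "\<sigma> > 0"
  shows "has_bochner_integral (lborel \<Otimes>\<^sub>M lborel)
    (indicator (lattice_cell p \<sigma> i \<times> lattice_cell q \<sigma> j) :: real \<times> real \<Rightarrow> real) (1 / \<sigma>\<^sup>2)"
proof -
  let ?cell = "lattice_cell p \<sigma> i \<times> lattice_cell q \<sigma> j"
  have "emeasure (lborel \<Otimes>\<^sub>M lborel) ?cell = ennreal (1 / \<sigma>) * ennreal (1 / \<sigma>)"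
    using assms by (subst lborel.emeasure_pair_measure_Times) (simp_all add: emeasure_lattice_cell)
  also have "\<dots> = ennreal (1 / \<sigma>\<^sup>2)"
    using assms by (simp add: ennreal_mult [symmetric] power2_eq_square)
  finally show ?thesis
    using has_bochner_integral_real_indicator[of ?cell "lborel \<Otimes>\<^sub>M lborel"]
    by (simp add: measure_def)
qed

definition lattice_step ::
    "real \<Rightarrow> real \<Rightarrow> real \<Rightarrow> nat \<Rightarrow> (nat \<Rightarrow> nat \<Rightarrow> real) \<Rightarrow> real \<times> real \<Rightarrow> real" where
  "lattice_step p q \<sigma> N h z =
     (\<Sum>i\<le>N. \<Sum>j\<le>N. h i j * indicator (lattice_cell p \<sigma> i \<times> lattice_cell q \<sigma> j) z)"

lemma has_bochner_integral_lattice_step: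
  assumes "\<sigma> > 0"
  shows "has_bochner_integral (lborel \<Otimes>\<^sub>M lborel) (lattice_step p q \<sigma> N h)
    ((\<Sum>i\<le>N. \<Sum>j\<le>N. h i j) / \<sigma>\<^sup>2)"
proof -
  have "has_bochner_integral (lborel \<Otimes>\<^sub>M lborel) (lattice_step p q \<sigma> N h)
      (\<Sum>i\<le>N. \<Sum>j\<le>N. h i j * (1 / \<sigma>\<^sup>2))"
    unfolding lattice_step_def [abs_def]
    by (intro has_bochner_integral_sum has_bochner_integral_mult_right
        has_bochner_integral_lattice_cell assms)
  then show ?thesis by (simp add: sum_divide_distrib)
qed

lemma lattice_step_eq:
  assumes "\<sigma> > 0" "x \<in> lattice_cell p \<sigma> i" "y \<in> lattice_cell q \<sigma> j" "i \<le> N" "j \<le> N"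
  shows "lattice_step p q \<sigma> N h (x, y) = h i j"
proof -
  have "x \<in> lattice_cell p \<sigma> k \<longleftrightarrow> k = i" "y \<in> lattice_cell q \<sigma> k \<longleftrightarrow> k = j" for k
    using assms by (auto simp: mem_lattice_cell_iff)
  then have "lattice_step p q \<sigma> N h (x, y) =
      (\<Sum>k\<le>N. if k = i then \<Sum>l\<le>N. if l = j then h k l else 0 else 0)"
    unfolding lattice_step_def by (intro sum.cong) (auto simp: indicator_def)
  then show ?thesis using assms by simp
qed

lemma lattice_step_eq_0:
  assumes "\<not> (\<exists>i\<le>N. \<exists>j\<le>N. x \<in> lattice_cell p \<sigma> i \<and> y \<in> lattice_cell q \<sigma> j)"
  shows "lattice_step p q \<sigma> N h (x, y) = 0"
  unfolding lattice_step_def using assms by (intro sum.neutral ballI) (auto simp: indicator_def)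

lemma norm_lattice_step_le:
  assumes "\<sigma> > 0" and w: "w (x, y) \<ge> 0"
    and bound: "\<And>i j. i \<le> N \<Longrightarrow> j \<le> N \<Longrightarrow> x \<in> lattice_cell p \<sigma> i \<Longrightarrow> y \<in> lattice_cell q \<sigma> j \<Longrightarrow>
      \<bar>h i j\<bar> \<le> w (x, y)"
  shows "norm (lattice_step p q \<sigma> N h (x, y)) \<le> w (x, y)"
proof (cases "\<exists>i\<le>N. \<exists>j\<le>N. x \<in> lattice_cell p \<sigma> i \<and> y \<in> lattice_cell q \<sigma> j")
  case True
  then show ?thesis using bound \<open>\<sigma> > 0\<close> by (auto simp: lattice_step_eq)
next
  case False
  then show ?thesis using w by (simp add: lattice_step_eq_0)
qed

definition exhausts_line :: "(nat \<Rightarrow> real) \<Rightarrow> (nat \<Rightarrow> real) \<Rightarrow> (nat \<Rightarrow> nat) \<Rightarrow> bool" where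
  "exhausts_line p \<sigma> N \<longleftrightarrow> filterlim (\<lambda>n. p n / \<sigma> n) at_top sequentially \<and>
     filterlim (\<lambda>n. (real (N n) - p n) / \<sigma> n) at_top sequentially"

lemma eventually_mem_lattice_cell:
  assumes "filterlim \<sigma> at_top sequentially" "exhausts_line p \<sigma> N"
  shows "\<forall>\<^sub>F n in sequentially. \<sigma> n > 0 \<and> lattice_index (p n) (\<sigma> n) x \<le> N n \<and>
    x \<in> lattice_cell (p n) (\<sigma> n) (lattice_index (p n) (\<sigma> n) x)"
proof -
  have "\<forall>\<^sub>F n in sequentially. 1 \<le> \<sigma> n" "\<forall>\<^sub>F n in sequentially. - x \<le> p n / \<sigma> n"
    "\<forall>\<^sub>F n in sequentially. x \<le> (real (N n) - p n) / \<sigma> n"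
    using assms by (simp_all add: exhausts_line_def filterlim_at_top)
  then show ?thesis
  proof eventually_elim
    case (elim n)
    then have "0 \<le> p n + \<sigma> n * x" "p n + \<sigma> n * x \<le> real (N n)"
      by (simp_all add: field_simps)
    then show ?case
      using elim by (simp add: mem_lattice_cell_iff) (simp add: lattice_index_def, linarith)
  qed
qed

lemma lattice_index_tendsto:
  assumes \<sigma>: "filterlim \<sigma> at_top sequentially" and p: "exhausts_line p \<sigma> N"
  shows "(\<lambda>n. (real (lattice_index (p n) (\<sigma> n) x) - p n) / \<sigma> n) \<longlonglongrightarrow> x"
proof -
  have "(\<lambda>n. (real (lattice_index (p n) (\<sigma> n) x) - p n) / \<sigma> n - x) \<longlonglongrightarrow> 0"
  proof (rule Lim_null_comparison)
    show "(\<lambda>n. 1 / \<sigma> n) \<longlonglongrightarrow> 0" by (rule filterlim_compose[OF _ \<sigma>]) real_asymp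
    show "\<forall>\<^sub>F n in sequentially.
        norm ((real (lattice_index (p n) (\<sigma> n) x) - p n) / \<sigma> n - x) \<le> 1 / \<sigma> n"
      using eventually_mem_lattice_cell[OF assms, of x]
      by eventually_elim (simp add: lattice_cell_dist_le)
  qed
  then show ?thesis by (simp add: LIM_zero_iff)
qed

lemma lattice_step_tendsto:
  assumes \<sigma>: "filterlim \<sigma> at_top sequentially"
    and p: "exhausts_line p \<sigma> N" and q: "exhausts_line q \<sigma> N"
    and lim: "\<And>i j. (\<lambda>n. (real (i n) - p n) / \<sigma> n) \<longlonglongrightarrow> x \<Longrightarrow> (\<lambda>n. (real (j n) - q n) / \<sigma> n) \<longlonglongrightarrow> y \<Longrightarrow>
      (\<lambda>n. f n (i n) (j n)) \<longlonglongrightarrow> l"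
  shows "(\<lambda>n. lattice_step (p n) (q n) (\<sigma> n) (N n) (f n) (x, y)) \<longlonglongrightarrow> l"
proof -
  have "(\<lambda>n. f n (lattice_index (p n) (\<sigma> n) x) (lattice_index (q n) (\<sigma> n) y)) \<longlonglongrightarrow> l"
    by (intro lim lattice_index_tendsto[OF \<sigma> p] lattice_index_tendsto[OF \<sigma> q])
  moreover have "\<forall>\<^sub>F n in sequentially.
      f n (lattice_index (p n) (\<sigma> n) x) (lattice_index (q n) (\<sigma> n) y)
      = lattice_step (p n) (q n) (\<sigma> n) (N n) (f n) (x, y)"
    using eventually_mem_lattice_cell[OF \<sigma> p, of x] eventually_mem_lattice_cell[OF \<sigma> q, of y]
    by eventually_elim (auto intro: lattice_step_eq [symmetric])
  ultimately show ?thesis by (rule Lim_transform_eventually)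
qed

theorem lattice_sum_dominated_convergence:
  fixes f :: "nat \<Rightarrow> nat \<Rightarrow> nat \<Rightarrow> real" and F w :: "real \<times> real \<Rightarrow> real"
  assumes \<sigma>: "filterlim \<sigma> at_top sequentially"
    and p: "exhausts_line p \<sigma> N" and q: "exhausts_line q \<sigma> N"
    and F: "F \<in> borel_measurable (lborel \<Otimes>\<^sub>M lborel)"
    and w: "integrable (lborel \<Otimes>\<^sub>M lborel) w" "\<And>z. w z \<ge> 0"
    and bound: "\<forall>\<^sub>F n in sequentially. \<forall>i\<le>N n. \<forall>j\<le>N n. \<forall>x\<in>lattice_cell (p n) (\<sigma> n) i.
      \<forall>y\<in>lattice_cell (q n) (\<sigma> n) j. \<bar>f n i j\<bar> \<le> w (x, y)"
    and lim: "\<And>x y i j. (\<lambda>n. (real (i n) - p n) / \<sigma> n) \<longlonglongrightarrow> x \<Longrightarrow>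
      (\<lambda>n. (real (j n) - q n) / \<sigma> n) \<longlonglongrightarrow> y \<Longrightarrow> (\<lambda>n. f n (i n) (j n)) \<longlonglongrightarrow> F (x, y)"
  shows "(\<lambda>n. (\<Sum>i\<le>N n. \<Sum>j\<le>N n. f n i j) / (\<sigma> n)\<^sup>2) \<longlonglongrightarrow> integral\<^sup>L (lborel \<Otimes>\<^sub>M lborel) F"
proof -
  define step where "step n = lattice_step (p n) (q n) (\<sigma> n) (N n) (f n)" for n
  define dominated where "dominated n \<longleftrightarrow> \<sigma> n > 0 \<and> (\<forall>i\<le>N n. \<forall>j\<le>N n.
      \<forall>x\<in>lattice_cell (p n) (\<sigma> n) i. \<forall>y\<in>lattice_cell (q n) (\<sigma> n) j. \<bar>f n i j\<bar> \<le> w (x, y))" for n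
  have "\<forall>\<^sub>F n in sequentially. \<sigma> n > 0" using \<sigma> by (simp add: filterlim_at_top_dense)
  then have "\<forall>\<^sub>F n in sequentially. dominated n"
    unfolding dominated_def using bound by (rule eventually_conj)
  then obtain n\<^sub>0 where n\<^sub>0: "\<And>n. n \<ge> n\<^sub>0 \<Longrightarrow> dominated n"
    by (auto simp: eventually_sequentially)
  have step_le: "norm (step n z) \<le> w z" if "n \<ge> n\<^sub>0" for n z
    using n\<^sub>0[OF that] w(2) unfolding step_def dominated_def
    by (cases z) (simp only:, intro norm_lattice_step_le; blast)
  have step_tendsto: "(\<lambda>n. step n z) \<longlonglongrightarrow> F z" for z
    unfolding step_def by (cases z) (simp only:, intro lattice_step_tendsto[OF \<sigma> p q] lim)
  have "(\<lambda>n. integral\<^sup>L (lborel \<Otimes>\<^sub>M lborel) (step (n + n\<^sub>0))) \<longlonglongrightarrow> integral\<^sup>L (lborel \<Otimes>\<^sub>M lborel) F"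
  proof (rule integral_dominated_convergence[OF F _ w(1)])
    show "step (n + n\<^sub>0) \<in> borel_measurable (lborel \<Otimes>\<^sub>M lborel)" for n
      unfolding step_def lattice_step_def [abs_def] by measurable
  qed (use step_le LIMSEQ_ignore_initial_segment[OF step_tendsto] in auto)
  moreover have "integral\<^sup>L (lborel \<Otimes>\<^sub>M lborel) (step (n + n\<^sub>0)) =
      (\<Sum>i\<le>N (n + n\<^sub>0). \<Sum>j\<le>N (n + n\<^sub>0). f (n + n\<^sub>0) i j) / (\<sigma> (n + n\<^sub>0))\<^sup>2" for n
    unfolding step_def using n\<^sub>0[of "n + n\<^sub>0"]
    by (intro has_bochner_integral_integral_eq has_bochner_integral_lattice_step)
       (simp add: dominated_def)
  ultimately show ?thesis by (auto intro: LIMSEQ_offset)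
qed

lemma half_square_minus_1_le_square:
  fixes v x :: real
  assumes "\<bar>v - x\<bar> \<le> 1"
  shows "x\<^sup>2 / 2 - 1 \<le> v\<^sup>2"
proof -
  have "(v - x)\<^sup>2 \<le> 1" using assms by (simp add: abs_square_le_1)
  moreover have "0 \<le> (2 * v - x)\<^sup>2" by simp
  ultimately show ?thesis by (simp add: power2_diff power_mult_distrib)
qed

lemma gaussian_le_on_lattice_cell:
  assumes "\<sigma> \<ge> 1" "\<kappa> > 0" and cells: "x \<in> lattice_cell p \<sigma> i" "y \<in> lattice_cell q \<sigma> j"
  shows "exp (- \<kappa> * (((real i - p) / \<sigma>)\<^sup>2 + ((real j - q) / \<sigma>)\<^sup>2))
    \<le> exp (2 * \<kappa>) * exp (- (\<kappa> / 2) * (x\<^sup>2 + y\<^sup>2))"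
proof -
  have "1 / \<sigma> \<le> 1" using \<open>\<sigma> \<ge> 1\<close> by simp
  then have "(x\<^sup>2 / 2 - 1) + (y\<^sup>2 / 2 - 1) \<le> ((real i - p) / \<sigma>)\<^sup>2 + ((real j - q) / \<sigma>)\<^sup>2"
    using cells[THEN lattice_cell_dist_le] by (intro add_mono half_square_minus_1_le_square) auto
  then have "\<kappa> * ((x\<^sup>2 / 2 - 1) + (y\<^sup>2 / 2 - 1)) \<le> \<kappa> * (((real i - p) / \<sigma>)\<^sup>2 + ((real j - q) / \<sigma>)\<^sup>2)"
    using \<open>\<kappa> > 0\<close> by (intro mult_left_mono) auto
  then have "- \<kappa> * (((real i - p) / \<sigma>)\<^sup>2 + ((real j - q) / \<sigma>)\<^sup>2) \<le> 2 * \<kappa> + - (\<kappa> / 2) * (x\<^sup>2 + y\<^sup>2)"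
    by (simp add: algebra_simps)
  then show ?thesis unfolding mult_exp_exp exp_le_cancel_iff .
qed

corollary lattice_sum_gaussian:
  fixes f :: "nat \<Rightarrow> nat \<Rightarrow> nat \<Rightarrow> real"
  assumes \<sigma>: "filterlim \<sigma> at_top sequentially"
    and p: "exhausts_line p \<sigma> N" and q: "exhausts_line q \<sigma> N"
    and \<kappa>: "\<kappa> > 0" and C: "C \<ge> 0"
    and bound: "\<forall>\<^sub>F n in sequentially. \<forall>i\<le>N n. \<forall>j\<le>N n.
      \<bar>f n i j\<bar> \<le> C * exp (- \<kappa> * (((real i - p n) / \<sigma> n)\<^sup>2 + ((real j - q n) / \<sigma> n)\<^sup>2))"
    and lim: "\<And>x y i j. (\<lambda>n. (real (i n) - p n) / \<sigma> n) \<longlonglongrightarrow> x \<Longrightarrow>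
      (\<lambda>n. (real (j n) - q n) / \<sigma> n) \<longlonglongrightarrow> y \<Longrightarrow> (\<lambda>n. f n (i n) (j n)) \<longlonglongrightarrow> exp (- (1 / 2) * (x\<^sup>2 + y\<^sup>2))"
  shows "(\<lambda>n. (\<Sum>i\<le>N n. \<Sum>j\<le>N n. f n i j) / (\<sigma> n)\<^sup>2) \<longlonglongrightarrow> 2 * pi"
proof -
  define gauss :: "real \<Rightarrow> real \<times> real \<Rightarrow> real"
    where "gauss a = (\<lambda>(x, y). exp (- a * (x\<^sup>2 + y\<^sup>2)))" for a
  note gauss_integral = has_bochner_integral_gaussian_pair[folded gauss_def]
  have "\<forall>\<^sub>F n in sequentially. \<sigma> n \<ge> 1" using \<sigma> by (simp add: filterlim_at_top)
  with bound have "\<forall>\<^sub>F n in sequentially. \<forall>i\<le>N n. \<forall>j\<le>N n. \<forall>x\<in>lattice_cell (p n) (\<sigma> n) i.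
      \<forall>y\<in>lattice_cell (q n) (\<sigma> n) j. \<bar>f n i j\<bar> \<le> C * (exp (2 * \<kappa>) * gauss (\<kappa> / 2) (x, y))"
  proof eventually_elim
    case (elim n)
    show ?case
      unfolding gauss_def prod.case
      using elim mult_left_mono[OF gaussian_le_on_lattice_cell[OF elim(2) \<kappa>] C]
      by (meson order_trans)
  qed
  then have "(\<lambda>n. (\<Sum>i\<le>N n. \<Sum>j\<le>N n. f n i j) / (\<sigma> n)\<^sup>2) \<longlonglongrightarrow>
      integral\<^sup>L (lborel \<Otimes>\<^sub>M lborel) (gauss (1 / 2))"
  proof (rule lattice_sum_dominated_convergence[OF \<sigma> p q, rotated 3])
    show "gauss (1 / 2) \<in> borel_measurable (lborel \<Otimes>\<^sub>M lborel)"
      unfolding gauss_def by measurable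
    show "integrable (lborel \<Otimes>\<^sub>M lborel) (\<lambda>z. C * (exp (2 * \<kappa>) * gauss (\<kappa> / 2) z))"
      using \<kappa> by (intro integrable_mult_right integrable.intros[OF gauss_integral]) simp
  qed (use C lim in \<open>auto simp: gauss_def\<close>)
  then show ?thesis
    using has_bochner_integral_integral_eq[OF gauss_integral[of "1 / 2"]]
    by (simp add: mult.commute)
qed

section \<open>The double sum and its logarithm\<close>

definition summand :: "nat \<Rightarrow> nat \<Rightarrow> nat \<Rightarrow> real" where
  "summand n i j = (if i + j \<le> n then fact n / (fact i * fact j * fact (n - i - j))
      * real j ^ (n - i - j + 1) * (1 + real i) ^ (n - i - j) else 0)"

lemma summand_nonneg: "summand n i j \<ge> 0"
  by (simp add: summand_def)

lemma c_eq_sum_summand: "c n = (\<Sum>i\<le>n. \<Sum>j\<le>n. summand n i j)"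
  unfolding c_def
proof (intro sum.cong refl)
  fix i j
  show "(\<Sum>t\<le>n. if i + j + t \<le> n then fact n / (fact i * fact j * fact t * fact (n - i - j - t))
            * real i ^ (n - i - j - t) * real j ^ (n - i - j + 1) else 0) = summand n i j"
  proof (cases "i + j \<le> n")
    case True
    define k where "k = n - i - j"
    have "(\<Sum>t\<le>n. if i + j + t \<le> n then fact n / (fact i * fact j * fact t * fact (n - i - j - t))
            * real i ^ (n - i - j - t) * real j ^ (n - i - j + 1) else 0)
       = (\<Sum>t\<le>k. fact n / (fact i * fact j * fact t * fact (k - t))
            * real i ^ (k - t) * real j ^ (k + 1))"
      by (intro sum.mono_neutral_cong_right) (use True in \<open>auto simp: k_def\<close>)
    also have "\<dots> = (\<Sum>t\<le>k. fact n / (fact i * fact j * fact k) * real j ^ (k + 1) *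
        (real (k choose t) * 1 ^ t * real i ^ (k - t)))"
      by (intro sum.cong refl) (simp add: binomial_fact field_simps)
    also have "\<dots> = fact n / (fact i * fact j * fact k) * real j ^ (k + 1) * (1 + real i) ^ k"
      unfolding binomial_ring[of 1 "real i" k] by (simp add: sum_distrib_left)
    finally show ?thesis using True by (simp add: summand_def k_def)
  qed (simp add: summand_def)
qed

definition log_summand :: "real \<Rightarrow> real \<Rightarrow> real \<Rightarrow> real" where
  "log_summand n x y = ln_Gamma (n + 1) - ln_Gamma (x + 1) - ln_Gamma (y + 1)
     - ln_Gamma (n - x - y + 1) + (n - x - y + 1) * ln y + (n - x - y) * ln (1 + x)"

definition log_summand_x :: "real \<Rightarrow> real \<Rightarrow> real \<Rightarrow> real" where
  "log_summand_x n x y = - Digamma (x + 1) + Digamma (n - x - y + 1) - ln y - ln (1 + x)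
     + (n - x - y) / (1 + x)"

definition log_summand_y :: "real \<Rightarrow> real \<Rightarrow> real \<Rightarrow> real" where
  "log_summand_y n x y = - Digamma (y + 1) + Digamma (n - x - y + 1) - ln y - ln (1 + x)
     + (n - x - y + 1) / y"

definition log_summand_slope :: "real \<Rightarrow> real \<Rightarrow> real \<Rightarrow> real \<Rightarrow> real \<Rightarrow> real" where
  "log_summand_slope n x y a b = log_summand_x n x y * a + log_summand_y n x y * b"

text \<open>The negated Hessian of \<open>log_summand\<close> as a quadratic form in \<open>(a, b)\<close>.\<close>

definition log_summand_quad :: "real \<Rightarrow> real \<Rightarrow> real \<Rightarrow> real \<Rightarrow> real \<Rightarrow> real" where
  "log_summand_quad n x y a b =
     (Polygamma 1 (x + 1) + 2 / (1 + x) + (n - x - y) / (1 + x)\<^sup>2) * a\<^sup>2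
     + (Polygamma 1 (y + 1) + 2 / y + (n - x - y + 1) / y\<^sup>2) * b\<^sup>2
     + Polygamma 1 (n - x - y + 1) * (a + b)\<^sup>2 + 2 * a * b * (1 / y + 1 / (1 + x))"

lemma summand_eq_exp_log_summand:
  assumes "i + j \<le> n" "j \<ge> 1"
  shows "summand n i j = exp (log_summand (real n) (real i) (real j))"
proof -
  define k where "k = n - i - j"
  have k: "real n - real i - real j = real k" using assms by (simp add: k_def)
  have ln_Gamma_fact: "ln_Gamma (real l + 1) = ln (fact l)" for l
    using ln_Gamma_real_conv_fact[of "Suc l"] by (simp add: add.commute)
  have "exp (log_summand n i j) = fact n / fact i / fact j / fact k
      * exp ((real k + 1) * ln j) * exp (real k * ln (1 + real i))"
    unfolding log_summand_def k ln_Gamma_fact by (simp add: exp_add exp_diff)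
  also have "(real k + 1) * ln j = real (k + 1) * ln j" by simp
  also have "exp (real (k + 1) * ln j) = real j ^ (k + 1)"
    using assms unfolding exp_of_nat_mult by simp
  also have "exp (real k * ln (1 + real i)) = (1 + real i) ^ k"
    unfolding exp_of_nat_mult by simp
  finally show ?thesis using assms(1) by (simp add: summand_def k_def)
qed

lemma has_real_derivative_log_summand_line:
  fixes n x y a b z :: real
  defines "X \<equiv> x + z * a" and "Y \<equiv> y + z * b"
  assumes pos: "0 \<le> X" "0 < Y" "X + Y \<le> n"
  shows "((\<lambda>z. log_summand n (x + z * a) (y + z * b)) has_real_derivative
    log_summand_slope n X Y a b) (at z)"
proof -
  have "((\<lambda>z. log_summand n (x + z * a) (y + z * b)) has_real_derivative
     (- (Digamma (X + 1) * a) - Digamma (Y + 1) * b - Digamma (n - X - Y + 1) * (- a - b)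
      + ((- a - b) * ln Y + (b / Y) * (n - X - Y + 1))
      + ((- a - b) * ln (1 + X) + (a / (1 + X)) * (n - X - Y)))) (at z)"
    unfolding log_summand_def using pos unfolding X_def Y_def
    by (auto intro!: derivative_eq_intros elim!: nonpos_Ints_cases)
  then show ?thesis
    by (rule DERIV_cong)
       (simp add: log_summand_slope_def log_summand_x_def log_summand_y_def ring_distribs mult_ac
          add_divide_distrib diff_divide_distrib)
qed

lemma has_real_derivative_log_summand_slope_line:
  fixes n x y a b z :: real
  defines "X \<equiv> x + z * a" and "Y \<equiv> y + z * b"
  assumes pos: "0 \<le> X" "0 < Y" "X + Y \<le> n"
  shows "((\<lambda>z. log_summand_slope n (x + z * a) (y + z * b) a b)
    has_real_derivative - log_summand_quad n X Y a b) (at z)"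
proof -
  have ni: "X + 1 \<notin> \<int>\<^sub>\<le>\<^sub>0" "Y + 1 \<notin> \<int>\<^sub>\<le>\<^sub>0" "n - X - Y + 1 \<notin> \<int>\<^sub>\<le>\<^sub>0"
    using pos by (auto elim!: nonpos_Ints_cases)
  define M' P where "M' = - a - b" and "P = Polygamma 1 (n - X - Y + 1) * M'"
  define D\<^sub>x D\<^sub>y where
    "D\<^sub>x = - (Polygamma 1 (X + 1) * a) + P - b / Y - a / (1 + X)
      + (M' * (1 + X) - (n - X - Y) * a) / ((1 + X) * (1 + X))"
    and "D\<^sub>y = - (Polygamma 1 (Y + 1) * b) + P - b / Y - a / (1 + X)
      + (M' * Y - (n - X - Y + 1) * b) / (Y * Y)"
  have "((\<lambda>z. log_summand_x n (x + z * a) (y + z * b)) has_real_derivative D\<^sub>x) (at z)"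
    "((\<lambda>z. log_summand_y n (x + z * a) (y + z * b)) has_real_derivative D\<^sub>y) (at z)"
    unfolding log_summand_x_def log_summand_y_def D\<^sub>x_def D\<^sub>y_def P_def M'_def
    using pos ni unfolding X_def Y_def
    by (auto intro!: derivative_eq_intros)
  then have "((\<lambda>z. log_summand_slope n (x + z * a) (y + z * b) a b)
      has_real_derivative D\<^sub>x * a + D\<^sub>y * b) (at z)"
    unfolding log_summand_slope_def by (intro DERIV_add DERIV_cmult_right)
  moreover have "D\<^sub>x * a + D\<^sub>y * b = - log_summand_quad n X Y a b"
  proof -
    have quotients: "(M' * (1 + X) - (n - X - Y) * a) / ((1 + X) * (1 + X))
        = M' / (1 + X) - (n - X - Y) / (1 + X)\<^sup>2 * a"
      "(M' * Y - (n - X - Y + 1) * b) / (Y * Y) = M' / Y - (n - X - Y + 1) / Y\<^sup>2 * b"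
      using pos by (simp_all add: divide_simps power2_eq_square)
    show ?thesis
      unfolding D\<^sub>x_def D\<^sub>y_def quotients P_def log_summand_quad_def
      by (simp add: M'_def algebra_simps power2_eq_square add_divide_distrib diff_divide_distrib)
  qed
  ultimately show ?thesis by simp
qed

lemma taylor_second_order:
  fixes f f' f'' :: "real \<Rightarrow> real"
  assumes "\<And>x. 0 \<le> x \<Longrightarrow> x \<le> 1 \<Longrightarrow> (f has_real_derivative f' x) (at x)"
    and "\<And>x. 0 \<le> x \<Longrightarrow> x \<le> 1 \<Longrightarrow> (f' has_real_derivative f'' x) (at x)"
  shows "\<exists>\<xi>. 0 < \<xi> \<and> \<xi> < 1 \<and> f 1 = f 0 + f' 0 + f'' \<xi> / 2"
proof -
  define d where "d = (\<lambda>k::nat. if k = 0 then f else if k = 1 then f' else f'')"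
  have "\<exists>t>0. t < 1 \<and> f 1 = (\<Sum>m<2. d m 0 / fact m * 1 ^ m) + d 2 t / fact 2 * 1 ^ 2"
    by (rule Maclaurin) (use assms in \<open>auto simp: d_def less_2_cases_iff\<close>)
  then show ?thesis by (simp add: d_def numeral_2_eq_2)
qed

lemma log_summand_taylor:
  assumes dom: "0 \<le> x" "0 < y" "x + y \<le> n" "0 \<le> x\<^sub>0" "0 < y\<^sub>0" "x\<^sub>0 + y\<^sub>0 \<le> n"
  defines "a \<equiv> x - x\<^sub>0" and "b \<equiv> y - y\<^sub>0"
  shows "\<exists>\<xi>. 0 < \<xi> \<and> \<xi> < 1 \<and> log_summand n x y =
    log_summand n x\<^sub>0 y\<^sub>0 + log_summand_slope n x\<^sub>0 y\<^sub>0 a b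
    - log_summand_quad n (x\<^sub>0 + \<xi> * a) (y\<^sub>0 + \<xi> * b) a b / 2"
proof -
  have segment: "0 \<le> x\<^sub>0 + z * a" "0 < y\<^sub>0 + z * b" "(x\<^sub>0 + z * a) + (y\<^sub>0 + z * b) \<le> n"
    if z: "0 \<le> z" "z \<le> 1" for z
  proof -
    show "0 \<le> x\<^sub>0 + z * a" "0 < y\<^sub>0 + z * b"
      unfolding a_def b_def by (intro segment_nonneg segment_pos z dom)+
    have "0 \<le> (n - x\<^sub>0 - y\<^sub>0) + z * ((n - x - y) - (n - x\<^sub>0 - y\<^sub>0))"
      using dom by (intro segment_nonneg z) auto
    then show "(x\<^sub>0 + z * a) + (y\<^sub>0 + z * b) \<le> n" by (simp add: a_def b_def algebra_simps)
  qed
  have "\<exists>\<xi>. 0 < \<xi> \<and> \<xi> < 1 \<and> log_summand n (x\<^sub>0 + 1 * a) (y\<^sub>0 + 1 * b) =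
      log_summand n (x\<^sub>0 + 0 * a) (y\<^sub>0 + 0 * b) + log_summand_slope n (x\<^sub>0 + 0 * a) (y\<^sub>0 + 0 * b) a b
      + - log_summand_quad n (x\<^sub>0 + \<xi> * a) (y\<^sub>0 + \<xi> * b) a b / 2"
    by (rule taylor_second_order)
       (intro has_real_derivative_log_summand_line has_real_derivative_log_summand_slope_line
          segment; assumption)+
  then show ?thesis by (simp add: a_def b_def)
qed

lemma summand_taylor:
  fixes x y :: real
  assumes "0 < x" "0 < y" "x + y \<le> real n" "i + j \<le> n" "1 \<le> j"
  defines "a \<equiv> real i - x" and "b \<equiv> real j - y"
  shows "\<exists>\<xi>. 0 < \<xi> \<and> \<xi> < 1 \<and> summand n i j =
    exp (log_summand n x y + log_summand_slope n x y a b
      - log_summand_quad n (x + \<xi> * a) (y + \<xi> * b) a b / 2)"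
proof -
  have "real i + real j \<le> real n" using assms by linarith
  then show ?thesis
    using log_summand_taylor[of "real i" "real j" "real n" x y] assms
    by (auto simp: summand_eq_exp_log_summand)
qed

lemma log_summand_quad_ge:
  assumes x: "0 \<le> x" and y: "0 < y" and xy: "x + y < n"
  defines "m \<equiv> n - x - y"
  shows "(m / (2 * (1 + x)\<^sup>2) - 2 / m) * a\<^sup>2 + (m / (2 * y\<^sup>2) - 2 / m) * b\<^sup>2
    \<le> log_summand_quad n x y a b"
proof -
  have m: "m > 0" using xy by (simp add: m_def)
  have poly_pos: "Polygamma 1 (x + 1) > 0" "Polygamma 1 (y + 1) > 0" "Polygamma 1 (m + 1) > 0"
    using x y m by (auto intro!: Polygamma1_pos simp del: One_nat_def)
  have split: "(m / (2 * z\<^sup>2) - 2 / m) * v\<^sup>2 = m / z\<^sup>2 * v\<^sup>2 - m / (2 * z\<^sup>2) * v\<^sup>2 - 2 / m * v\<^sup>2"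
    for v z :: real
    by (simp add: left_diff_distrib)
  have cross: "- (2 * v * w / z) \<le> m / (2 * z\<^sup>2) * v\<^sup>2 + 2 / m * w\<^sup>2" for v w z :: real
    using two_mult_le_weighted_squares[of "m / 2" "v / z" w] m by (simp add: power_divide)
  have "m / (1 + x)\<^sup>2 * a\<^sup>2 \<le> (Polygamma 1 (x + 1) + 2 / (1 + x) + m / (1 + x)\<^sup>2) * a\<^sup>2"
    using poly_pos x by (intro mult_right_mono) auto
  moreover have "m / y\<^sup>2 * b\<^sup>2 \<le> (Polygamma 1 (y + 1) + 2 / y + (m + 1) / y\<^sup>2) * b\<^sup>2"
    using poly_pos y by (intro mult_right_mono) (auto simp: add_divide_distrib)
  moreover have "0 \<le> Polygamma 1 (m + 1) * (a + b)\<^sup>2" using poly_pos by simp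
  moreover have "2 * a * b * (1 / y + 1 / (1 + x)) = 2 * b * a / y + 2 * a * b / (1 + x)"
    by (simp add: algebra_simps)
  ultimately show ?thesis
    using cross[of a b "1 + x"] cross[of b a y] split[of "1 + x" a] split[of y b]
    unfolding log_summand_quad_def m_def [symmetric] by linarith
qed

section \<open>Decay of the summands beyond the cutoff\<close>

lemma one_plus_inverse_power_le_sqrt:
  assumes "n \<ge> 2" "x \<ge> 4 * centre n" "k \<le> n"
  shows "(1 + 1 / x) ^ k \<le> sqrt (real n)"
proof -
  have x: "x > 0" using assms centre_pos[OF assms(1)] by linarith
  have "(1 + 1 / x) ^ k \<le> exp (1 / x) ^ k"
    using x by (intro power_mono exp_ge_add_one_self add_nonneg_nonneg) auto
  also have "\<dots> = exp (real k / x)" by (simp add: exp_of_nat_mult [symmetric])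
  also have "\<dots> \<le> exp (real n / x)" using x assms by (simp add: divide_right_mono)
  also have "\<dots> \<le> exp (ln (real n) / 2)" using assms x by (simp add: centre_def field_simps)
  also have "\<dots> = sqrt (real n)" using assms by (simp add: ln_sqrt [symmetric])
  finally show ?thesis .
qed

lemma summand_Suc_fst:
  assumes "Suc i + j \<le> n" "j \<ge> 1"
  defines "k \<equiv> n - Suc i - j"
  shows "summand n (Suc i) j =
    summand n i j * (real (Suc k) * (1 + 1 / (1 + real i)) ^ k / (real j * (1 + real i)\<^sup>2))"
proof -
  define P where "P = fact n / (fact i * fact j * fact k) * real j ^ (k + 1) * (1 + real i) ^ k"
  have k: "n - i - j = Suc k" "n - Suc i - j = k" using assms by (auto simp: k_def)
  have "summand n i j = P * (real j * (1 + real i) / real (Suc k))"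
    unfolding summand_def k P_def using assms(1) by (simp add: mult_ac)
  moreover have "summand n (Suc i) j = P * ((1 + 1 / (1 + real i)) ^ k / (1 + real i))"
  proof -
    have "(1 + real i) * (1 + 1 / (1 + real i)) = 1 + real (Suc i)" by (simp add: field_simps)
    then have "(1 + real (Suc i)) ^ k = (1 + real i) ^ k * (1 + 1 / (1 + real i)) ^ k"
      by (simp only: power_mult_distrib [symmetric])
    then show ?thesis unfolding summand_def k P_def using assms(1) by (simp add: add_ac mult_ac)
  qed
  ultimately show ?thesis using assms(2) by (simp add: power2_eq_square)
qed

lemma summand_Suc_snd:
  assumes "i + Suc j \<le> n" "j \<ge> 1"
  defines "k \<equiv> n - i - Suc j"
  shows "summand n i (Suc j) =
    summand n i j * (real (Suc k) * (1 + 1 / real j) ^ k / ((real j)\<^sup>2 * (1 + real i)))"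
proof -
  define P where "P = fact n / (fact i * fact j * fact k) * real j ^ k * (1 + real i) ^ k"
  have k: "n - i - j = Suc k" "n - i - Suc j = k" using assms by (auto simp: k_def)
  have "summand n i j = P * ((real j)\<^sup>2 * (1 + real i) / real (Suc k))"
    unfolding summand_def k P_def using assms(1) by (simp add: power2_eq_square mult_ac)
  moreover have "summand n i (Suc j) = P * (1 + 1 / real j) ^ k"
  proof -
    have "real j * (1 + 1 / real j) = real (Suc j)" using assms by (simp add: field_simps)
    then have "real (Suc j) ^ k = real j ^ k * (1 + 1 / real j) ^ k"
      by (simp only: power_mult_distrib [symmetric])
    then show ?thesis unfolding summand_def k P_def using assms(1) by (simp add: mult_ac)
  qed
  ultimately show ?thesis using assms(2) by simp
qed

text \<open>Beyond \<open>4 * centre n\<close> the only growing factor, \<open>(1 + 1 / x) ^ k\<close>, is at most \<open>sqrt n\<close>, which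
  loses against \<open>k / x\<^sup>2\<close>.\<close>

lemma Suc_mult_one_plus_inverse_power_le:
  assumes n: "n \<ge> 2" and x: "x \<ge> 4 * centre n" and k: "Suc k \<le> n"
    and large: "real n * sqrt (real n) \<le> (4 * centre n)\<^sup>2"
  shows "real (Suc k) * (1 + 1 / x) ^ k \<le> x\<^sup>2"
proof -
  have "0 \<le> 4 * centre n" using centre_pos[OF n] by simp
  then have "0 \<le> x" using x by linarith
  then have "real (Suc k) * (1 + 1 / x) ^ k \<le> real n * sqrt (real n)"
    using k by (intro mult_mono one_plus_inverse_power_le_sqrt[OF n x]) auto
  also have "\<dots> \<le> (4 * centre n)\<^sup>2" by (rule large)
  also have "\<dots> \<le> x\<^sup>2" using x \<open>0 \<le> 4 * centre n\<close> by (intro power_mono)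
  finally show ?thesis .
qed

lemma summand_Suc_fst_le:
  assumes n: "n \<ge> 2" and i: "real i \<ge> 4 * centre n"
    and large: "real n * sqrt (real n) \<le> (4 * centre n)\<^sup>2"
  shows "summand n (Suc i) j \<le> summand n i j"
proof (cases "Suc i + j \<le> n \<and> j \<ge> 1")
  case True
  define k where "k = n - Suc i - j"
  have "real (Suc k) * (1 + 1 / (1 + real i)) ^ k \<le> (1 + real i)\<^sup>2"
    using True i by (intro Suc_mult_one_plus_inverse_power_le[OF n _ _ large]) (auto simp: k_def)
  also have "\<dots> \<le> real j * (1 + real i)\<^sup>2" using True by simp
  finally have "real (Suc k) * (1 + 1 / (1 + real i)) ^ k / (real j * (1 + real i)\<^sup>2) \<le> 1"
    using True by (simp add: divide_le_eq)
  from mult_left_mono[OF this summand_nonneg[of n i j]]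
  show ?thesis using summand_Suc_fst[of i j n, folded k_def] True by simp
next
  case False
  then have "summand n (Suc i) j = 0" by (auto simp: summand_def not_le)
  then show ?thesis using summand_nonneg by simp
qed

lemma summand_Suc_snd_le:
  assumes n: "n \<ge> 2" and j: "real j \<ge> 4 * centre n"
    and large: "real n * sqrt (real n) \<le> (4 * centre n)\<^sup>2"
  shows "summand n i (Suc j) \<le> summand n i j"
proof (cases "i + Suc j \<le> n")
  case True
  have "real j > 0" using j centre_pos[OF n] by linarith
  then have "j \<ge> 1" by simp
  define k where "k = n - i - Suc j"
  have "real (Suc k) * (1 + 1 / real j) ^ k \<le> (real j)\<^sup>2"
    using True j by (intro Suc_mult_one_plus_inverse_power_le[OF n _ _ large]) (auto simp: k_def)
  also have "\<dots> \<le> (real j)\<^sup>2 * (1 + real i)" by (simp add: algebra_simps)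
  finally have "real (Suc k) * (1 + 1 / real j) ^ k / ((real j)\<^sup>2 * (1 + real i)) \<le> 1"
    using \<open>j \<ge> 1\<close> by (simp add: divide_le_eq)
  from mult_left_mono[OF this summand_nonneg[of n i j]]
  show ?thesis using summand_Suc_snd[of i j n, folded k_def] True \<open>j \<ge> 1\<close> by simp
qed (auto simp: summand_def summand_nonneg)

lemma summand_le_clamped:
  assumes n: "n \<ge> 2" and N: "real N \<ge> 4 * centre n"
    and large: "real n * sqrt (real n) \<le> (4 * centre n)\<^sup>2"
  shows "summand n i j \<le> summand n (min i N) (min j N)"
proof -
  have "summand n (N + (i - N)) j \<le> summand n (N + 0) j"
    by (rule lift_Suc_antimono_le[of "\<lambda>k. summand n (N + k) j"])
       (use summand_Suc_fst_le[OF n _ large] N in auto)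
  then have "summand n i j \<le> summand n (min i N) j" by (cases "i \<le> N") auto
  also have "summand n (min i N) (N + (j - N)) \<le> summand n (min i N) (N + 0)"
    by (rule lift_Suc_antimono_le[of "\<lambda>k. summand n (min i N) (N + k)"])
       (use summand_Suc_snd_le[OF n _ large] N in auto)
  then have "summand n (min i N) j \<le> summand n (min i N) (min j N)" by (cases "j \<le> N") auto
  finally show ?thesis .
qed

section \<open>The width of the peak\<close>

definition width :: "nat \<Rightarrow> real" where
  "width n = sqrt (real n) / (2 * ln (real n))"

lemma width_at_top: "filterlim width at_top sequentially"
  unfolding width_def [abs_def] by real_asymp

lemma width_square: "(width n)\<^sup>2 = real n / (4 * (ln (real n))\<^sup>2)"
  by (simp add: width_def power_divide power_mult_distrib)

lemma log_summand_quad_ge_width: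
  assumes x: "0 \<le> x" "1 + x \<le> 6 * centre n" and y: "0 < y" "y \<le> 6 * centre n"
    and xy: "x + y \<le> real n / 2" and L_ge: "ln (real n) \<ge> 17"
  shows "((a / width n)\<^sup>2 + (b / width n)\<^sup>2) / 288 \<le> log_summand_quad n x y a b"
proof -
  define m where "m = real n - x - y"
  define L where "L = ln (real n)"
  have n: "n > 0" "centre n > 0" and L: "L \<ge> 17"
    using centre_bounds[OF L_ge] L_ge by (simp_all add: L_def)
  have m: "m \<ge> real n / 2" "m > 0" using xy n by (simp_all add: m_def)
  have coeff: "L\<^sup>2 / (72 * real n) * d\<^sup>2 \<le> (m / (2 * z\<^sup>2) - 2 / m) * d\<^sup>2"
    if z: "0 < z" "z \<le> 6 * centre n" for z d
  proof (rule mult_right_mono)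
    have "L\<^sup>2 / (36 * real n) = real n / 2 / (2 * (6 * centre n)\<^sup>2)"
      using n L by (simp add: centre_def L_def [symmetric] power_divide power2_eq_square)
    also have "\<dots> \<le> m / (2 * (6 * centre n)\<^sup>2)" using m by (intro divide_right_mono) auto
    also have "\<dots> \<le> m / (2 * z\<^sup>2)"
      using m z n L by (intro divide_left_mono mult_left_mono power_mono mult_pos_pos) auto
    finally have "L\<^sup>2 / (36 * real n) \<le> m / (2 * z\<^sup>2)" .
    moreover have "2 / m \<le> 4 / real n" using m n by (simp add: field_simps)
    moreover have "4 / real n \<le> L\<^sup>2 / (72 * real n)"
      using power_mono[of 17 L 2] L n by (simp add: field_simps)
    moreover have "L\<^sup>2 / (36 * real n) = L\<^sup>2 / (72 * real n) + L\<^sup>2 / (72 * real n)" by simp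
    ultimately show "L\<^sup>2 / (72 * real n) \<le> m / (2 * z\<^sup>2) - 2 / m" by linarith
  qed simp
  have "((a / width n)\<^sup>2 + (b / width n)\<^sup>2) / 288 = L\<^sup>2 / (72 * real n) * a\<^sup>2 + L\<^sup>2 / (72 * real n) * b\<^sup>2"
    using n L unfolding power_divide[of _ "width n"] width_square L_def [symmetric]
    by (simp add: field_simps)
  also have "\<dots> \<le> (m / (2 * (1 + x)\<^sup>2) - 2 / m) * a\<^sup>2 + (m / (2 * y\<^sup>2) - 2 / m) * b\<^sup>2"
    using x y by (intro add_mono coeff) (auto simp: L_def)
  also have "\<dots> \<le> log_summand_quad n x y a b"
    unfolding m_def using x y xy n by (intro log_summand_quad_ge) auto
  finally show ?thesis .
qed

lemma width_square_mult_tendsto: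
  fixes f g :: "nat \<Rightarrow> real"
  assumes "f \<sim>[sequentially] g" "(\<lambda>n. (width n)\<^sup>2 * g n) \<longlonglongrightarrow> l"
  shows "(\<lambda>n. (width n)\<^sup>2 * f n) \<longlonglongrightarrow> l"
  using assms(2)
    tendsto_asymp_equiv_cong[OF asymp_equiv_mult[OF asymp_equiv_refl[of "\<lambda>n. (width n)\<^sup>2"] assms(1)]]
  by blast

lemma width_square_mult_Polygamma1_tendsto:
  fixes f g :: "nat \<Rightarrow> real"
  assumes fg: "f \<sim>[sequentially] g" and g: "filterlim g at_top sequentially"
    and lim: "(\<lambda>n. (width n)\<^sup>2 * (1 / g n)) \<longlonglongrightarrow> 0"
  shows "(\<lambda>n. (width n)\<^sup>2 * Polygamma 1 (f n + 1)) \<longlonglongrightarrow> 0"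
proof (rule width_square_mult_tendsto[OF _ lim])
  have "filterlim f at_top sequentially"
    using asymp_equiv_at_top_transfer[OF asymp_equiv_symI[OF fg] g] .
  then have "(\<lambda>n. Polygamma 1 (f n + 1)) \<sim>[sequentially] (\<lambda>n. 1 / f n)"
    by (rule asymp_equiv_compose'[OF Polygamma1_plus1_asymp_equiv])
  also have "\<dots> \<sim>[sequentially] (\<lambda>n. 1 / g n)" by (intro asymp_equiv_intros fg)
  finally show "(\<lambda>n. Polygamma 1 (f n + 1)) \<sim>[sequentially] (\<lambda>n. 1 / g n)" .
qed

lemma asymp_equiv_real_minus_centre:
  fixes f g :: "nat \<Rightarrow> real"
  assumes "f \<sim>[sequentially] centre" "g \<sim>[sequentially] centre"
  shows "(\<lambda>n. real n - f n - g n) \<sim>[sequentially] real"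
proof (rule smallo_imp_asymp_equiv)
  have "f \<in> o(real)" "g \<in> o(real)"
    using assms by (blast intro: landau_o.big_small_trans asymp_equiv_imp_bigo centre_smallo)+
  then have "(\<lambda>n. - f n - g n) \<in> o(real)" by (intro sum_in_smallo) simp_all
  then show "(\<lambda>n. real n - f n - g n - real n) \<in> o(real)" by simp
qed

lemma width_square_mult_centre_tendsto:
  fixes f g :: "nat \<Rightarrow> real"
  assumes g: "g \<sim>[sequentially] centre"
  shows "(\<lambda>n. (width n)\<^sup>2 * Polygamma 1 (g n + 1)) \<longlonglongrightarrow> 0"
    and "(\<lambda>n. (width n)\<^sup>2 * (1 / g n)) \<longlonglongrightarrow> 0"
    and "f \<sim>[sequentially] real \<Longrightarrow> (\<lambda>n. (width n)\<^sup>2 * (f n / (g n)\<^sup>2)) \<longlonglongrightarrow> 1"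
proof -
  show "(\<lambda>n. (width n)\<^sup>2 * Polygamma 1 (g n + 1)) \<longlonglongrightarrow> 0"
    by (rule width_square_mult_Polygamma1_tendsto[OF g centre_at_top])
       (unfold width_def centre_def, real_asymp)
  show "(\<lambda>n. (width n)\<^sup>2 * (1 / g n)) \<longlonglongrightarrow> 0"
    by (rule width_square_mult_tendsto[OF asymp_equiv_divide[OF asymp_equiv_refl g]])
       (unfold width_def centre_def, real_asymp)
  show "(\<lambda>n. (width n)\<^sup>2 * (f n / (g n)\<^sup>2)) \<longlonglongrightarrow> 1" if "f \<sim>[sequentially] real"
    by (rule width_square_mult_tendsto[OF asymp_equiv_divide[OF that asymp_equiv_power[OF g]]])
       (unfold width_def centre_def, real_asymp)
qed

lemma log_summand_quad_tendsto:
  fixes X Y \<alpha> \<beta> :: "nat \<Rightarrow> real"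
  assumes X: "X \<sim>[sequentially] centre"
    and Y: "Y \<sim>[sequentially] centre"
    and \<alpha>: "\<alpha> \<longlonglongrightarrow> x" and \<beta>: "\<beta> \<longlonglongrightarrow> y"
  shows "(\<lambda>n. log_summand_quad n (X n) (Y n) (\<alpha> n * width n) (\<beta> n * width n)) \<longlonglongrightarrow> x\<^sup>2 + y\<^sup>2"
proof -
  define M where "M n = real n - X n - Y n" for n
  have M: "M \<sim>[sequentially] real"
    unfolding M_def [abs_def] using X Y by (rule asymp_equiv_real_minus_centre)
  then have M1: "(\<lambda>n. M n + 1) \<sim>[sequentially] real"
    by (rule asymp_equiv_add_const[OF _ filterlim_real_sequentially])
  have X1: "(\<lambda>n. 1 + X n) \<sim>[sequentially] centre"
    using asymp_equiv_add_const[OF X centre_at_top, of 1] by (simp add: add.commute)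
  have Polygamma_M: "(\<lambda>n. (width n)\<^sup>2 * Polygamma 1 (M n + 1)) \<longlonglongrightarrow> 0"
    by (rule width_square_mult_Polygamma1_tendsto[OF M filterlim_real_sequentially])
       (unfold width_def, real_asymp)
  have "(\<lambda>n.
      ((width n)\<^sup>2 * Polygamma 1 (X n + 1) + 2 * ((width n)\<^sup>2 * (1 / (1 + X n)))
        + (width n)\<^sup>2 * (M n / (1 + X n)\<^sup>2)) * (\<alpha> n)\<^sup>2
      + ((width n)\<^sup>2 * Polygamma 1 (Y n + 1) + 2 * ((width n)\<^sup>2 * (1 / Y n))
        + (width n)\<^sup>2 * ((M n + 1) / (Y n)\<^sup>2)) * (\<beta> n)\<^sup>2
      + (width n)\<^sup>2 * Polygamma 1 (M n + 1) * (\<alpha> n + \<beta> n)\<^sup>2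
      + 2 * \<alpha> n * \<beta> n * ((width n)\<^sup>2 * (1 / Y n) + (width n)\<^sup>2 * (1 / (1 + X n))))
    \<longlonglongrightarrow> (0 + 2 * 0 + 1) * x\<^sup>2 + (0 + 2 * 0 + 1) * y\<^sup>2 + 0 * (x + y)\<^sup>2 + 2 * x * y * (0 + 0)"
    by (intro tendsto_intros \<alpha> \<beta> Polygamma_M
        width_square_mult_centre_tendsto(1)[OF X] width_square_mult_centre_tendsto(1)[OF Y]
        width_square_mult_centre_tendsto(2,3)[OF X1] width_square_mult_centre_tendsto(2,3)[OF Y]
        M M1)
  then show ?thesis
    unfolding log_summand_quad_def M_def
    by (simp add: power_mult_distrib algebra_simps power2_eq_square)
qed

lemma asymp_equiv_add_width:
  fixes f \<alpha> :: "nat \<Rightarrow> real"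
  assumes f: "f \<sim>[sequentially] centre" and \<alpha>: "\<alpha> \<in> O(\<lambda>_. 1)"
  shows "(\<lambda>n. f n + \<alpha> n * width n) \<sim>[sequentially] centre"
proof -
  have "(\<lambda>n. \<alpha> n * width n) \<in> O(\<lambda>n. 1 * width n)" using \<alpha> by (rule landau_o.big.mult_right)
  also have "(\<lambda>n. 1 * width n) \<in> o(centre)" unfolding width_def centre_def [abs_def] by real_asymp
  finally show ?thesis using f by (simp add: asymp_equiv_add_right)
qed

lemma gradient_mult_width_tendsto:
  fixes g \<alpha> :: "nat \<Rightarrow> real"
  assumes g: "g \<in> O(\<lambda>n. ln (real n) / real n)" and \<alpha>: "\<alpha> \<longlonglongrightarrow> x"
  shows "(\<lambda>n. g n * (\<alpha> n * width n)) \<longlonglongrightarrow> 0"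
proof -
  have "(\<lambda>n. g n * width n) \<in> O(\<lambda>n. ln (real n) / real n * width n)" using g
    by (rule landau_o.big.mult_right)
  also have "(\<lambda>n. ln (real n) / real n * width n) \<in> o(\<lambda>_. 1)" unfolding width_def by real_asymp
  finally have "(\<lambda>n. g n * width n) \<longlonglongrightarrow> 0" using smalloD_tendsto by fastforce
  then have "(\<lambda>n. g n * width n * \<alpha> n) \<longlonglongrightarrow> 0 * x" using \<alpha> by (rule tendsto_mult)
  then show ?thesis by (simp add: mult_ac)
qed

section \<open>The Gaussian shape of the summands\<close>

definition cutoff :: "nat \<Rightarrow> nat" where
  "cutoff n = nat \<lceil>4 * centre n\<rceil>"

lemma cutoff_bounds:
  assumes "n \<ge> 2"
  shows "4 * centre n \<le> real (cutoff n)" "real (cutoff n) \<le> 4 * centre n + 1"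
proof -
  have "4 * centre n \<ge> 0" using centre_pos[OF assms] by simp
  then show "4 * centre n \<le> real (cutoff n)" "real (cutoff n) \<le> 4 * centre n + 1"
    unfolding cutoff_def by linarith+
qed

definition scaled_dist2 :: "nat \<Rightarrow> real \<Rightarrow> real \<Rightarrow> nat \<Rightarrow> nat \<Rightarrow> real" where
  "scaled_dist2 n x y i j = ((real i - x) / width n)\<^sup>2 + ((real j - y) / width n)\<^sup>2"

lemma log_summand_quad_segment_ge:
  assumes n: "ln (real n) \<ge> 17"
    and xy: "0 < x" "0 < y" "x \<le> 2 * centre n" "y \<le> 2 * centre n"
    and ij: "i \<le> cutoff n" "j \<le> cutoff n" "1 \<le> j" and \<xi>: "0 \<le> \<xi>" "\<xi> \<le> 1"
  shows "scaled_dist2 n x y i j / 288 \<le>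
    log_summand_quad n (x + \<xi> * (real i - x)) (y + \<xi> * (real j - y)) (real i - x) (real j - y)"
proof -
  note centre = centre_bounds[OF n]
  have "real i \<le> 5 * centre n" "real j \<le> 5 * centre n" "x \<le> 5 * centre n" "y \<le> 5 * centre n"
    using ij xy cutoff_bounds(2)[OF centre(1)] centre(2) by linarith+
  then have "x + \<xi> * (real i - x) \<le> 5 * centre n" "y + \<xi> * (real j - y) \<le> 5 * centre n"
    using \<xi> by (simp_all add: segment_le)
  moreover have "0 \<le> x + \<xi> * (real i - x)" "0 < y + \<xi> * (real j - y)"
    using xy ij by (intro segment_nonneg segment_pos \<xi>; simp)+
  ultimately show ?thesis
    using n centre unfolding scaled_dist2_def by (intro log_summand_quad_ge_width; linarith)
qed

lemma summand_le_gaussian: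
  assumes n: "ln (real n) \<ge> 17"
    and xy: "0 < x" "0 < y" "x \<le> 2 * centre n" "y \<le> 2 * centre n"
    and grad: "\<bar>log_summand_x n x y\<bar> \<le> K * (ln (real n) / real n)"
      "\<bar>log_summand_y n x y\<bar> \<le> K * (ln (real n) / real n)"
    and ij: "i \<le> cutoff n" "j \<le> cutoff n"
  shows "summand n i j \<le>
    exp (5 * K) * exp (log_summand n x y) * exp (- (1 / 576) * scaled_dist2 n x y i j)"
proof (cases "1 \<le> j")
  case True
  note centre = centre_bounds[OF n]
  define a b where "a = real i - x" and "b = real j - y"
  have ij_le: "real i \<le> 5 * centre n" "real j \<le> 5 * centre n"
    using ij cutoff_bounds(2)[OF centre(1)] centre(2) by linarith+
  then have "real i + real j \<le> real n" using centre by linarith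
  then have "i + j \<le> n" by linarith
  have "x + y \<le> real n" and a: "\<bar>a\<bar> \<le> 5 * centre n" and b: "\<bar>b\<bar> \<le> 5 * centre n"
    using xy ij_le centre unfolding a_def b_def by linarith+
  then obtain \<xi> where \<xi>: "0 < \<xi>" "\<xi> < 1" and taylor: "summand n i j =
      exp (log_summand n x y + log_summand_slope n x y a b
        - log_summand_quad n (x + \<xi> * a) (y + \<xi> * b) a b / 2)"
    using summand_taylor[OF xy(1,2) _ \<open>i + j \<le> n\<close> True] unfolding a_def b_def by blast
  have linear: "g * d \<le> 5 / 2 * K"
    if "\<bar>g\<bar> \<le> K * (ln (real n) / real n)" "\<bar>d\<bar> \<le> 5 * centre n" for g d
  proof -
    have "g * d \<le> \<bar>g\<bar> * \<bar>d\<bar>" by (simp add: abs_mult [symmetric])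
    also have "\<dots> \<le> K * (ln (real n) / real n) * (5 * centre n)"
      using that by (intro mult_mono) auto
    also have "\<dots> = 5 / 2 * K" using n centre by (simp add: centre_def)
    finally show ?thesis .
  qed
  have "log_summand_slope n x y a b \<le> 5 * K"
    using linear[OF grad(1) a] linear[OF grad(2) b] unfolding log_summand_slope_def by linarith
  moreover have "scaled_dist2 n x y i j / 288 \<le> log_summand_quad n (x + \<xi> * a) (y + \<xi> * b) a b"
    unfolding a_def b_def using \<xi> by (intro log_summand_quad_segment_ge n xy ij True) auto
  ultimately show ?thesis
    unfolding taylor mult_exp_exp exp_le_cancel_iff by linarith
next
  case False
  then have "j = 0" by simp
  then show ?thesis by (simp add: summand_def)
qed

context saddle_sequence
begin

definition peak :: "nat \<Rightarrow> real" where
  "peak n = log_summand n (r n) (s n)"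

lemma inverse_r_bigo: "(\<lambda>n. 1 / r n) \<in> O(\<lambda>n. ln (real n) / real n)"
proof -
  have "(\<lambda>n. 1 / r n) \<in> O(\<lambda>n. 1 / centre n)"
    by (intro asymp_equiv_imp_bigo asymp_equiv_intros r_asymp_equiv)
  also have "(\<lambda>n. 1 / centre n) \<in> O(\<lambda>n. ln (real n) / real n)" unfolding centre_def by real_asymp
  finally show ?thesis .
qed

lemma Digamma_m_minus_Digamma_u_bigo:
  "(\<lambda>n. Digamma (m n + 1) - Digamma (u n + 1)) \<in> O(\<lambda>n. ln (real n) / real n)"
proof -
  have "(\<lambda>n. Digamma (m n + 1) - Digamma (u n + 1)) \<in> O(\<lambda>n. t n / u n)"
  proof (rule bigoI[where c = 1])
    show "\<forall>\<^sub>F n in sequentially. norm (Digamma (m n + 1) - Digamma (u n + 1)) \<le> 1 * norm (t n / u n)"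
      using saddle
    proof eventually_elim
      case (elim n)
      then have "t n > 0" "u n > 0" using saddle_point_pos[OF elim] by (simp_all add: u_def)
      then show ?case
        using Digamma_plus1_diff_le[of "u n" "m n"] Digamma_real_mono[of "u n + 1" "m n + 1"]
        by (simp add: m_eq)
    qed
  qed
  also have "(\<lambda>n. t n / u n) \<in> O(\<lambda>n. 2 * ln (real n) / real n)"
    by (intro asymp_equiv_imp_bigo asymp_equiv_intros t_asymp_equiv u_asymp_equiv)
  also have "(\<lambda>n. 2 * ln (real n) / real n) \<in> O(\<lambda>n. ln (real n) / real n)" by real_asymp
  finally show ?thesis .
qed

lemma quotient_diff_bigo: "(\<lambda>n. m n / (1 + r n) - u n / r n) \<in> O(\<lambda>n. ln (real n) / real n)"
proof -
  have "(\<lambda>n. - (m n / r n - t n) + t n / r n) \<longlonglongrightarrow> - (1 / 2) + 0"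
    by (intro tendsto_intros m_over_r_minus_t_tendsto t_over_r_tendsto)
  then have "(\<lambda>n. - (m n / r n - t n) + t n / r n) \<in> O(\<lambda>_. 1)" by (intro bigoI_tendsto) auto
  moreover have "(\<lambda>n. 1 / (1 + r n)) \<in> O(\<lambda>n. 1 / r n)"
    by (rule landau_o.big.compose[OF _ r_at_top]) real_asymp
  ultimately have "(\<lambda>n. (- (m n / r n - t n) + t n / r n) * (1 / (1 + r n))) \<in> O(\<lambda>n. 1 * (1 / r n))"
    by (rule landau_o.big.mult)
  moreover have "\<forall>\<^sub>F n in sequentially.
      (- (m n / r n - t n) + t n / r n) * (1 / (1 + r n)) = m n / (1 + r n) - u n / r n"
    using eventually_saddle_bounds
    by eventually_elim (simp add: m_eq divide_simps, simp add: algebra_simps)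
  ultimately have "(\<lambda>n. m n / (1 + r n) - u n / r n) \<in> O(\<lambda>n. 1 / r n)"
    by (simp add: landau_o.big.in_cong)
  then show ?thesis using inverse_r_bigo by (rule landau_o.big_trans)
qed

lemma log_summand_gradient_bigo:
  shows "(\<lambda>n. log_summand_x n (r n) (s n)) \<in> O(\<lambda>n. ln (real n) / real n)"
    and "(\<lambda>n. log_summand_y n (r n) (s n)) \<in> O(\<lambda>n. ln (real n) / real n)"
proof -
  define g where
    "g n = (Digamma (m n + 1) - Digamma (u n + 1)) - (ln (1 + r n) - ln (r n))" for n
  have "(\<lambda>n. ln (1 + r n) - ln (r n)) \<in> O(\<lambda>n. 1 / r n)"
    by (rule landau_o.big.compose[OF _ r_at_top]) real_asymp
  then have "(\<lambda>n. ln (1 + r n) - ln (r n)) \<in> O(\<lambda>n. ln (real n) / real n)"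
    using inverse_r_bigo by (rule landau_o.big_trans)
  with Digamma_m_minus_Digamma_u_bigo have y: "g \<in> O(\<lambda>n. ln (real n) / real n)"
    unfolding g_def [abs_def] by (rule sum_in_bigo(2))
  then have x: "(\<lambda>n. g n + (m n / (1 + r n) - u n / r n)) \<in> O(\<lambda>n. ln (real n) / real n)"
    using quotient_diff_bigo by (rule sum_in_bigo(1))
  have "\<forall>\<^sub>F n in sequentially.
      log_summand_x n (r n) (s n) = g n + (m n / (1 + r n) - u n / r n)"
    using saddle
    by eventually_elim
       (simp add: g_def log_summand_x_def saddle_point_iff phase_r_def m_def u_def)
  with x show "(\<lambda>n. log_summand_x n (r n) (s n)) \<in> O(\<lambda>n. ln (real n) / real n)"
    by (simp add: landau_o.big.in_cong)
  have "\<forall>\<^sub>F n in sequentially. log_summand_y n (r n) (s n) = g n"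
    using saddle
    by eventually_elim
       (simp add: g_def log_summand_y_def saddle_point_iff phase_s_def m_def u_def)
  with y show "(\<lambda>n. log_summand_y n (r n) (s n)) \<in> O(\<lambda>n. ln (real n) / real n)"
    by (simp add: landau_o.big.in_cong)
qed

lemma eventually_saddle_location:
  "\<forall>\<^sub>F n in sequentially. ln (real n) \<ge> 17 \<and>
     0 < r n \<and> 0 < s n \<and> r n \<le> 2 * centre n \<and> s n \<le> 2 * centre n"
proof -
  have "\<forall>\<^sub>F n :: nat in sequentially. ln (real n) \<ge> 17" by real_asymp
  with eventually_le_centre[OF r_asymp_equiv] eventually_le_centre[OF s_asymp_equiv] show ?thesis
    by eventually_elim auto
qed

lemma summand_dominated:
  "\<exists>C\<ge>0. \<forall>\<^sub>F n in sequentially. \<forall>i\<le>cutoff n. \<forall>j\<le>cutoff n.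
     summand n i j \<le> C * exp (peak n) * exp (- (1 / 576) * scaled_dist2 n (r n) (s n) i j)"
proof -
  obtain K\<^sub>x K\<^sub>y where
    "\<forall>\<^sub>F n in sequentially. norm (log_summand_x n (r n) (s n)) \<le> K\<^sub>x * norm (ln (real n) / real n)"
    "\<forall>\<^sub>F n in sequentially. norm (log_summand_y n (r n) (s n)) \<le> K\<^sub>y * norm (ln (real n) / real n)"
    using log_summand_gradient_bigo by (elim landau_o.bigE)
  then have "\<forall>\<^sub>F n in sequentially. \<forall>i\<le>cutoff n. \<forall>j\<le>cutoff n. summand n i j \<le>
      exp (5 * max K\<^sub>x K\<^sub>y) * exp (peak n) * exp (- (1 / 576) * scaled_dist2 n (r n) (s n) i j)"
    using eventually_saddle_location
  proof eventually_elim
    case (elim n)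
    have nonneg: "0 \<le> ln (real n) / real n" using elim by simp
    then have "\<bar>log_summand_x n (r n) (s n)\<bar> \<le> max K\<^sub>x K\<^sub>y * (ln (real n) / real n)"
      "\<bar>log_summand_y n (r n) (s n)\<bar> \<le> max K\<^sub>x K\<^sub>y * (ln (real n) / real n)"
      using elim mult_right_mono[OF max.cobounded1 nonneg, of K\<^sub>x K\<^sub>y]
        mult_right_mono[OF max.cobounded2 nonneg, of K\<^sub>y K\<^sub>x]
      unfolding real_norm_def abs_of_nonneg[OF nonneg] by linarith+
    then show ?case
      unfolding peak_def using elim by (intro allI impI summand_le_gaussian) auto
  qed
  then show ?thesis by (intro exI[of _ "exp (5 * max K\<^sub>x K\<^sub>y)"]) simp
qed

lemma eventually_indices_in_range:
  fixes i j :: "nat \<Rightarrow> nat"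
  assumes "(\<lambda>n. real (i n)) \<sim>[sequentially] centre"
    and "(\<lambda>n. real (j n)) \<sim>[sequentially] centre"
  shows "\<forall>\<^sub>F n in sequentially. i n + j n \<le> n \<and> 1 \<le> j n \<and> r n + s n \<le> real n"
  using eventually_le_centre[OF assms(1)] eventually_le_centre[OF assms(2)]
    eventually_saddle_location
proof eventually_elim
  case (elim n)
  have "4 * centre n \<le> real n" using centre_bounds[of n] elim by linarith
  then have "real (i n) + real (j n) \<le> real n" "r n + s n \<le> real n" using elim by linarith+
  then show ?case using elim by linarith
qed

lemma eventually_summand_taylor:
  fixes i j :: "nat \<Rightarrow> nat"
  assumes bounded: "\<alpha> \<in> O(\<lambda>_. 1)" "\<beta> \<in> O(\<lambda>_. 1)"
    and displacement: "\<forall>\<^sub>F n in sequentially.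
      real (i n) = r n + \<alpha> n * width n \<and> real (j n) = s n + \<beta> n * width n"
  shows "\<exists>\<xi>. \<forall>\<^sub>F n in sequentially. 0 < \<xi> n \<and> \<xi> n < 1 \<and> summand n (i n) (j n) =
    exp (peak n + log_summand_slope n (r n) (s n) (\<alpha> n * width n) (\<beta> n * width n)
      - log_summand_quad n (r n + \<xi> n * \<alpha> n * width n) (s n + \<xi> n * \<beta> n * width n)
          (\<alpha> n * width n) (\<beta> n * width n) / 2)"
proof -
  have "(\<lambda>n. real (i n)) \<sim>[sequentially] centre" "(\<lambda>n. real (j n)) \<sim>[sequentially] centre"
    by (rule asymp_equiv_transfer[OF asymp_equiv_add_width[OF r_asymp_equiv bounded(1)]]
          asymp_equiv_transfer[OF asymp_equiv_add_width[OF s_asymp_equiv bounded(2)]];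
        use displacement in \<open>auto elim!: eventually_mono\<close>)+
  then have "\<forall>\<^sub>F n in sequentially. i n + j n \<le> n \<and> 1 \<le> j n \<and> r n + s n \<le> real n"
    by (rule eventually_indices_in_range)
  then have "\<forall>\<^sub>F n in sequentially. \<exists>\<xi>. 0 < \<xi> \<and> \<xi> < 1 \<and> summand n (i n) (j n) =
      exp (peak n + log_summand_slope n (r n) (s n) (\<alpha> n * width n) (\<beta> n * width n)
        - log_summand_quad n (r n + \<xi> * \<alpha> n * width n) (s n + \<xi> * \<beta> n * width n)
            (\<alpha> n * width n) (\<beta> n * width n) / 2)"
    using displacement eventually_saddle_location
  proof eventually_elim
    case (elim n)
    then show ?case
      using summand_taylor[of "r n" "s n" n "i n" "j n"] by (simp add: peak_def mult.assoc)
  qed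
  then show ?thesis by (rule eventually_ex[THEN iffD1])
qed

lemma summand_tendsto:
  fixes i j :: "nat \<Rightarrow> nat"
  assumes i: "(\<lambda>n. (real (i n) - r n) / width n) \<longlonglongrightarrow> x"
    and j: "(\<lambda>n. (real (j n) - s n) / width n) \<longlonglongrightarrow> y"
  shows "(\<lambda>n. summand n (i n) (j n) / exp (peak n)) \<longlonglongrightarrow> exp (- (1 / 2) * (x\<^sup>2 + y\<^sup>2))"
proof -
  define \<alpha> \<beta> where "\<alpha> n = (real (i n) - r n) / width n"
    and "\<beta> n = (real (j n) - s n) / width n" for n
  have \<alpha>: "\<alpha> \<longlonglongrightarrow> x" and \<beta>: "\<beta> \<longlonglongrightarrow> y"
    using i j unfolding \<alpha>_def [abs_def] \<beta>_def [abs_def] by simp_all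
  then have bounded: "\<alpha> \<in> O(\<lambda>_. 1)" "\<beta> \<in> O(\<lambda>_. 1)" by (auto intro: bigoI_tendsto)
  have "\<forall>\<^sub>F n in sequentially. width n > 0" using width_at_top by (simp add: filterlim_at_top_dense)
  then have "\<forall>\<^sub>F n in sequentially.
      real (i n) = r n + \<alpha> n * width n \<and> real (j n) = s n + \<beta> n * width n"
    by eventually_elim (simp add: \<alpha>_def \<beta>_def)
  then obtain \<xi> where taylor: "\<forall>\<^sub>F n in sequentially. 0 < \<xi> n \<and> \<xi> n < 1 \<and>
      summand n (i n) (j n) =
      exp (peak n + log_summand_slope n (r n) (s n) (\<alpha> n * width n) (\<beta> n * width n)
        - log_summand_quad n (r n + \<xi> n * \<alpha> n * width n) (s n + \<xi> n * \<beta> n * width n)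
            (\<alpha> n * width n) (\<beta> n * width n) / 2)"
    using eventually_summand_taylor[OF bounded] by blast
  define slope quad where
    "slope n = log_summand_slope n (r n) (s n) (\<alpha> n * width n) (\<beta> n * width n)"
    and "quad n = log_summand_quad n (r n + \<xi> n * \<alpha> n * width n) (s n + \<xi> n * \<beta> n * width n)
      (\<alpha> n * width n) (\<beta> n * width n)" for n
  have "\<xi> \<in> O(\<lambda>_. 1)"
    by (rule bigoI[where c = 1]) (use taylor in eventually_elim, auto)
  then have "(\<lambda>n. \<xi> n * \<alpha> n) \<in> O(\<lambda>_. 1)" "(\<lambda>n. \<xi> n * \<beta> n) \<in> O(\<lambda>_. 1)"
    using landau_o.big.mult[OF _ bounded(1)] landau_o.big.mult[OF _ bounded(2)] by fastforce+
  then have "quad \<longlonglongrightarrow> x\<^sup>2 + y\<^sup>2"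
    unfolding quad_def
    by (intro log_summand_quad_tendsto asymp_equiv_add_width r_asymp_equiv s_asymp_equiv \<alpha> \<beta>)
  moreover have "slope \<longlonglongrightarrow> 0 + 0"
    unfolding slope_def log_summand_slope_def
    by (intro tendsto_add gradient_mult_width_tendsto[OF _ \<alpha>] gradient_mult_width_tendsto[OF _ \<beta>]
        log_summand_gradient_bigo)
  ultimately have "(\<lambda>n. exp (slope n - quad n / 2)) \<longlonglongrightarrow> exp (0 + 0 - (x\<^sup>2 + y\<^sup>2) / 2)"
    by (intro tendsto_intros) auto
  moreover have "\<forall>\<^sub>F n in sequentially.
      exp (slope n - quad n / 2) = summand n (i n) (j n) / exp (peak n)"
    using taylor by eventually_elim (simp add: slope_def quad_def exp_diff exp_add)
  ultimately show ?thesis by (simp add: tendsto_cong)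
qed

lemma cutoff_exhausts_line:
  assumes f: "f \<sim>[sequentially] centre"
  shows "exhausts_line f width cutoff"
  unfolding exhausts_line_def
proof
  have "(\<lambda>n. centre n / width n) \<sim>[sequentially] (\<lambda>n. f n / width n)"
    by (intro asymp_equiv_intros asymp_equiv_symI[OF f])
  moreover have "filterlim (\<lambda>n. centre n / width n) at_top sequentially"
    unfolding width_def centre_def by real_asymp
  ultimately show "filterlim (\<lambda>n. f n / width n) at_top sequentially"
    by (rule asymp_equiv_at_top_transfer)
  have "\<forall>\<^sub>F n :: nat in sequentially. n \<ge> 2" "\<forall>\<^sub>F n in sequentially. width n > 0"
    using width_at_top by (simp_all add: filterlim_at_top_dense eventually_ge_at_top)
  with eventually_le_centre[OF f]
  have "\<forall>\<^sub>F n in sequentially. 2 * centre n / width n \<le> (real (cutoff n) - f n) / width n"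
  proof eventually_elim
    case (elim n)
    then show ?case using cutoff_bounds(1)[of n] by (intro divide_right_mono) linarith+
  qed
  moreover have "filterlim (\<lambda>n. 2 * centre n / width n) at_top sequentially"
    unfolding width_def centre_def by real_asymp
  ultimately show "filterlim (\<lambda>n. (real (cutoff n) - f n) / width n) at_top sequentially"
    by (rule filterlim_at_top_mono[rotated])
qed

lemma cutoff_sum_tendsto:
  "(\<lambda>n. (\<Sum>i\<le>cutoff n. \<Sum>j\<le>cutoff n. summand n i j / exp (peak n)) / (width n)\<^sup>2) \<longlonglongrightarrow> 2 * pi"
proof -
  obtain C where "C \<ge> 0" and dominated: "\<forall>\<^sub>F n in sequentially. \<forall>i\<le>cutoff n. \<forall>j\<le>cutoff n.
     summand n i j \<le> C * exp (peak n) * exp (- (1 / 576) * scaled_dist2 n (r n) (s n) i j)"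
    using summand_dominated by blast
  then have "\<forall>\<^sub>F n in sequentially. \<forall>i\<le>cutoff n. \<forall>j\<le>cutoff n. \<bar>summand n i j / exp (peak n)\<bar> \<le>
     C * exp (- (1 / 576) * (((real i - r n) / width n)\<^sup>2 + ((real j - s n) / width n)\<^sup>2))"
    by (simp add: scaled_dist2_def abs_of_nonneg summand_nonneg divide_le_eq mult_ac)
  from lattice_sum_gaussian[OF width_at_top cutoff_exhausts_line[OF r_asymp_equiv]
      cutoff_exhausts_line[OF s_asymp_equiv] _ \<open>C \<ge> 0\<close> this summand_tendsto]
  show ?thesis by simp
qed

end

lemma scaled_dist2_ge:
  assumes n: "n \<ge> 2" and xy: "x \<le> 2 * centre n" "y \<le> 2 * centre n"
    and ij: "cutoff n \<le> i \<or> cutoff n \<le> j"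
  shows "4 * real n \<le> scaled_dist2 n x y i j"
proof -
  have far: "4 * real n \<le> ((real k - z) / width n)\<^sup>2" if "z \<le> 2 * centre n" "cutoff n \<le> k" for k z
  proof -
    have "4 * real n = (2 * centre n)\<^sup>2 / (width n)\<^sup>2"
      unfolding width_square using n by (simp add: centre_def power_divide power2_eq_square)
    also have "\<dots> \<le> (real k - z)\<^sup>2 / (width n)\<^sup>2"
      using that cutoff_bounds(1)[OF n] centre_pos[OF n]
      by (intro divide_right_mono power_mono) auto
    finally show ?thesis by (simp add: power_divide)
  qed
  show ?thesis using ij
  proof
    assume "cutoff n \<le> i"
    then show ?thesis using far[OF xy(1)] unfolding scaled_dist2_def by (simp add: add_increasing2)
  next
    assume "cutoff n \<le> j"
    then show ?thesis using far[OF xy(2)] unfolding scaled_dist2_def by (simp add: add_increasing)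
  qed
qed

lemma summand_le_outside_cutoff:
  assumes n: "n \<ge> 2" and large: "real n * sqrt (real n) \<le> (4 * centre n)\<^sup>2"
    and xy: "x \<le> 2 * centre n" "y \<le> 2 * centre n"
    and "B \<ge> 0" and dominated: "\<forall>i\<le>cutoff n. \<forall>j\<le>cutoff n.
      summand n i j \<le> B * exp (- (1 / 576) * scaled_dist2 n x y i j)"
    and ij: "cutoff n < i \<or> cutoff n < j"
  shows "summand n i j \<le> B * exp (- (real n / 144))"
proof -
  define i' j' where "i' = min i (cutoff n)" and "j' = min j (cutoff n)"
  have "summand n i j \<le> summand n i' j'"
    unfolding i'_def j'_def by (rule summand_le_clamped[OF n cutoff_bounds(1)[OF n] large])
  also have "\<dots> \<le> B * exp (- (1 / 576) * scaled_dist2 n x y i' j')"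
    using dominated by (simp add: i'_def j'_def)
  also have "\<dots> \<le> B * exp (- (real n / 144))"
  proof (intro mult_left_mono)
    have "4 * real n \<le> scaled_dist2 n x y i' j'"
      using ij by (intro scaled_dist2_ge n xy) (auto simp: i'_def j'_def)
    then show "exp (- (1 / 576) * scaled_dist2 n x y i' j') \<le> exp (- (real n / 144))" by simp
  qed (rule \<open>B \<ge> 0\<close>)
  finally show ?thesis .
qed

lemma c_minus_cutoff_sum_le:
  assumes "cutoff n \<le> n"
    and outside: "\<And>i j. cutoff n < i \<or> cutoff n < j \<Longrightarrow> summand n i j \<le> B"
  shows "\<bar>c n - (\<Sum>i\<le>cutoff n. \<Sum>j\<le>cutoff n. summand n i j)\<bar> \<le> (real n + 1)\<^sup>2 * B"
proof -
  define A where "A = {..n} \<times> {..n} - {..cutoff n} \<times> {..cutoff n}"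
  have "0 \<le> B" using outside[of "Suc (cutoff n)" 0] summand_nonneg order_trans by blast
  have "c n - (\<Sum>i\<le>cutoff n. \<Sum>j\<le>cutoff n. summand n i j) = (\<Sum>(i, j)\<in>A. summand n i j)"
    unfolding c_eq_sum_summand sum.cartesian_product A_def
    by (subst sum_diff) (use \<open>cutoff n \<le> n\<close> in auto)
  moreover have "0 \<le> (\<Sum>(i, j)\<in>A. summand n i j)"
    by (intro sum_nonneg) (auto simp: summand_nonneg)
  moreover have "(\<Sum>(i, j)\<in>A. summand n i j) \<le> (\<Sum>z\<in>A. B)"
    by (intro sum_mono) (auto simp: A_def intro!: outside)
  moreover have "(\<Sum>z\<in>A. B) \<le> (real n + 1)\<^sup>2 * B"
  proof -
    have "card A \<le> card ({..n} \<times> {..n})" by (intro card_mono) (auto simp: A_def)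
    then have "real (card A) \<le> real (Suc n * Suc n)"
      by (simp only: card_cartesian_product card_atMost of_nat_le_iff)
    also have "\<dots> = (real n + 1)\<^sup>2" by (simp add: power2_eq_square algebra_simps)
    finally show ?thesis using \<open>0 \<le> B\<close> by (simp add: mult_right_mono)
  qed
  ultimately show ?thesis by simp
qed

context saddle_sequence
begin

lemma tail_tendsto:
  "(\<lambda>n. (c n - (\<Sum>i\<le>cutoff n. \<Sum>j\<le>cutoff n. summand n i j)) / exp (peak n) / (width n)\<^sup>2)
    \<longlonglongrightarrow> 0"
proof -
  define tail where "tail n = c n - (\<Sum>i\<le>cutoff n. \<Sum>j\<le>cutoff n. summand n i j)" for n
  obtain C where "C \<ge> 0" and dominated: "\<forall>\<^sub>F n in sequentially. \<forall>i\<le>cutoff n. \<forall>j\<le>cutoff n.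
     summand n i j \<le> C * exp (peak n) * exp (- (1 / 576) * scaled_dist2 n (r n) (s n) i j)"
    using summand_dominated by blast
  have large: "\<forall>\<^sub>F n :: nat in sequentially. real n * sqrt (real n) \<le> (4 * centre n)\<^sup>2"
    unfolding centre_def by real_asymp
  have "\<forall>\<^sub>F n in sequentially.
      \<bar>tail n\<bar> / exp (peak n) \<le> (real n + 1)\<^sup>2 * (C * exp (- (real n / 144)))"
    using dominated large eventually_saddle_location
  proof eventually_elim
    case (elim n)
    note n = centre_bounds[of n]
    have "n \<ge> 2" using n elim by blast
    have "real (cutoff n) \<le> real n" using n elim cutoff_bounds(2)[OF \<open>n \<ge> 2\<close>] by linarith
    moreover have "summand n i j \<le> C * exp (peak n) * exp (- (real n / 144))"
      if "cutoff n < i \<or> cutoff n < j" for i j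
      using elim \<open>C \<ge> 0\<close>
      by (intro summand_le_outside_cutoff[OF \<open>n \<ge> 2\<close> _ _ _ _ elim(1) that]) auto
    ultimately have "\<bar>tail n\<bar> \<le> (real n + 1)\<^sup>2 * (C * exp (peak n) * exp (- (real n / 144)))"
      unfolding tail_def by (intro c_minus_cutoff_sum_le) auto
    then show ?case by (simp add: divide_le_eq mult_ac)
  qed
  then have "\<forall>\<^sub>F n in sequentially. norm (tail n / exp (peak n) / (width n)\<^sup>2)
      \<le> (real n + 1)\<^sup>2 * (C * exp (- (real n / 144))) / (width n)\<^sup>2"
    by eventually_elim
       (simp only: real_norm_def abs_divide abs_exp_cancel abs_power2 divide_right_mono
         zero_le_power2)
  moreover have "(\<lambda>n. (real n + 1)\<^sup>2 * (C * exp (- (real n / 144))) / (width n)\<^sup>2) \<longlonglongrightarrow> 0"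
    unfolding width_def by real_asymp
  ultimately show ?thesis unfolding tail_def by (rule Lim_null_comparison)
qed

lemma c_asymp_equiv_peak: "c \<sim>[sequentially] (\<lambda>n. 2 * pi * exp (peak n) * (width n)\<^sup>2)"
proof (rule asymp_equivI')
  have "(\<lambda>n. ((\<Sum>i\<le>cutoff n. \<Sum>j\<le>cutoff n. summand n i j / exp (peak n)) / (width n)\<^sup>2
      + (c n - (\<Sum>i\<le>cutoff n. \<Sum>j\<le>cutoff n. summand n i j)) / exp (peak n) / (width n)\<^sup>2) / (2 * pi))
    \<longlonglongrightarrow> (2 * pi + 0) / (2 * pi)"
    by (intro tendsto_intros cutoff_sum_tendsto tail_tendsto) simp
  then show "(\<lambda>n. c n / (2 * pi * exp (peak n) * (width n)\<^sup>2)) \<longlonglongrightarrow> 1"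
    by (simp add: sum_divide_distrib [symmetric] add_divide_distrib [symmetric]
        diff_divide_distrib mult_ac)
qed

end

section \<open>The value at the saddle point\<close>

definition ln1p_error :: "real \<Rightarrow> real" where
  "ln1p_error x = ln (1 + x) - x"

lemma mult_ln1p_error_tendsto:
  fixes k x :: "'a \<Rightarrow> real"
  assumes x: "(x \<longlongrightarrow> 0) F" and kx: "((\<lambda>z. k z * (x z)\<^sup>2) \<longlongrightarrow> 0) F"
  shows "((\<lambda>z. k z * ln1p_error (x z)) \<longlongrightarrow> 0) F"
proof (rule Lim_null_comparison)
  have "((\<lambda>z. 2 * \<bar>k z * (x z)\<^sup>2\<bar>) \<longlongrightarrow> 2 * \<bar>0\<bar>) F" by (intro tendsto_intros kx)
  then show "((\<lambda>z. 2 * \<bar>k z * (x z)\<^sup>2\<bar>) \<longlongrightarrow> 0) F" by simp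
  have "\<forall>\<^sub>F z in F. \<bar>x z\<bar> < 1 / 2"
    using order_tendstoD(2)[OF tendsto_rabs[OF x], of "1 / 2"] by simp
  then show "\<forall>\<^sub>F z in F. norm (k z * ln1p_error (x z)) \<le> 2 * \<bar>k z * (x z)\<^sup>2\<bar>"
  proof eventually_elim
    case (elim z)
    then have "\<bar>k z\<bar> * \<bar>ln1p_error (x z)\<bar> \<le> \<bar>k z\<bar> * (2 * (x z)\<^sup>2)"
      unfolding ln1p_error_def
      by (intro mult_left_mono abs_ln_one_plus_x_minus_x_bound) auto
    then show ?case by (simp add: abs_mult)
  qed
qed

lemma mult_digamma_error_tendsto:
  fixes k f g :: "nat \<Rightarrow> real"
  assumes k: "k \<in> O(real)" and f: "f \<sim>[sequentially] g" and g: "filterlim g at_top sequentially"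
    and lim: "(\<lambda>n. real n * (1 / (g n)\<^sup>2)) \<longlonglongrightarrow> 0"
  shows "(\<lambda>n. k n * digamma_error (f n)) \<longlonglongrightarrow> 0"
proof -
  have "filterlim f at_top sequentially"
    by (rule asymp_equiv_at_top_transfer[OF asymp_equiv_symI[OF f] g])
  then have "(\<lambda>n. digamma_error (f n)) \<in> O(\<lambda>n. 1 / (f n)\<^sup>2)"
    by (rule landau_o.big.compose[OF digamma_error_bigo])
  also have "(\<lambda>n. 1 / (f n)\<^sup>2) \<in> O(\<lambda>n. 1 / (g n)\<^sup>2)"
    by (intro asymp_equiv_imp_bigo asymp_equiv_intros f)
  finally have "(\<lambda>n. k n * digamma_error (f n)) \<in> O(\<lambda>n. real n * (1 / (g n)\<^sup>2))"
    using k by (intro landau_o.big.mult)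
  moreover have "(\<lambda>n. real n * (1 / (g n)\<^sup>2)) \<in> o(\<lambda>_. 1)" using lim by (intro smalloI_tendsto) auto
  ultimately have "(\<lambda>n. k n * digamma_error (f n)) \<in> o(\<lambda>_. 1)" by (rule landau_o.big_small_trans)
  then show ?thesis using smalloD_tendsto by fastforce
qed

context saddle_sequence
begin

definition exponent :: "nat \<Rightarrow> real" where
  "exponent n = real n / s n * (real n - r n + 1 / 2) - 3 * real n + 2 * r n + 2 * s n + t n + 1"

text \<open>The part of \<open>peak n - n * ln (n / s n)\<close> that does not come from the square roots in Stirling's
  formula.\<close>

definition leading :: "nat \<Rightarrow> real" where
  "leading n = (2 * m n + r n) * ln (s n) + m n * ln (1 + r n) - r n * ln (r n) - m n * ln (m n)"

lemma peak_eq_leading: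
  assumes "r n > 0" "s n > 0" "m n > 0" "n > 0"
  shows "peak n = real n * ln (real n / s n) + leading n + (ln (real n / m n) + ln (s n / r n)) / 2
    + (stirling_error n - stirling_error (r n) - stirling_error (s n) - stirling_error (m n))"
proof -
  have "peak n = (real n * ln (real n) + ln (real n) / 2 - real n + stirling_error (real n))
      - (r n * ln (r n) + ln (r n) / 2 - r n + stirling_error (r n))
      - (s n * ln (s n) + ln (s n) / 2 - s n + stirling_error (s n))
      - (m n * ln (m n) + ln (m n) / 2 - m n + stirling_error (m n))
      + (m n + 1) * ln (s n) + m n * ln (1 + r n)"
    unfolding peak_def log_summand_def m_def [symmetric] using assms
    by (simp add: ln_Gamma_plus1_eq_stirling)
  moreover have "real n * ln (real n / s n) = real n * ln (real n) - (m n + r n + s n) * ln (s n)"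
    using assms by (simp add: m_def ln_div right_diff_distrib)
  moreover have "real n = m n + r n + s n" by (simp add: m_def)
  moreover have "ln (real n / m n) = ln (real n) - ln (m n)" "ln (s n / r n) = ln (s n) - ln (r n)"
    using assms by (simp_all add: ln_div)
  ultimately show ?thesis
    by (simp add: leading_def distrib_right add_divide_distrib diff_divide_distrib)
qed

lemma saddle_log_equations_digamma_error:
  assumes "saddle_point n (r n) (s n) (t n)"
  shows "ln (r n) + 2 * ln (s n) - ln (u n) =
      (m n + 1 / 2) / s n + 1 / (2 * u n) + digamma_error (u n) - digamma_error (s n)"
    and "ln (s n) - ln (r n) =
      (m n + 1 / 2) / s n - (u n - 1 / 2) / r n + digamma_error (r n) - digamma_error (s n)"
proof -
  have pos: "r n > 0" "s n > 0" using saddle_point_pos[OF assms] by simp_all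
  have phases: "- ln (r n) - ln (s n) + u n / r n - Digamma (r n + 1) + Digamma (u n + 1) = 0"
    "- ln (r n) - ln (s n) + (m n + 1) / s n - Digamma (s n + 1) + Digamma (u n + 1) = 0"
    using assms by (simp_all add: saddle_point_iff phase_r_def phase_s_def u_def m_def)
  have "(m n + 1) / s n - 1 / (2 * s n) = (m n + 1 / 2) / s n"
    "u n / r n - 1 / (2 * r n) = (u n - 1 / 2) / r n"
    using pos by (simp_all add: field_simps)
  with phases show "ln (r n) + 2 * ln (s n) - ln (u n) =
      (m n + 1 / 2) / s n + 1 / (2 * u n) + digamma_error (u n) - digamma_error (s n)"
    and "ln (s n) - ln (r n) =
      (m n + 1 / 2) / s n - (u n - 1 / 2) / r n + digamma_error (r n) - digamma_error (s n)"
    unfolding digamma_error_def by linarith+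
qed

definition leading_error :: "nat \<Rightarrow> real" where
  "leading_error n = m n * ln1p_error (- t n / m n) + m n * ln1p_error (1 / r n)
     + (m n / r n - t n) + m n / u n / 2 - 1
     + (m n * digamma_error (u n) - m n * digamma_error (s n))
     + (r n * digamma_error (r n) - r n * digamma_error (s n))"

lemma leading_eq_exponent:
  assumes sp: "saddle_point n (r n) (s n) (t n)"
  shows "leading n = exponent n + leading_error n"
proof -
  have pos: "r n > 0" "s n > 0" "u n > 0" "m n > 0"
    using saddle_point_pos[OF sp] by (simp_all add: u_def m_def)
  have "1 + - t n / m n = u n / m n" "1 + 1 / r n = (1 + r n) / r n"
    using pos by (simp_all add: m_eq field_simps)
  then have logs: "ln (1 + - t n / m n) = ln (u n) - ln (m n)"
    "ln (1 + 1 / r n) = ln (1 + r n) - ln (r n)"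
    using pos by (simp_all add: ln_div)
  have "leading n = m n * (ln (r n) + 2 * ln (s n) - ln (u n)) + r n * (ln (s n) - ln (r n))
      + m n * ln (1 + - t n / m n) + m n * ln (1 + 1 / r n)"
    unfolding leading_def logs by (simp add: algebra_simps)
  moreover have "m n * (ln (r n) + 2 * ln (s n) - ln (u n)) = m n * ((m n + 1 / 2) / s n)
      + m n / u n / 2 + m n * digamma_error (u n) - m n * digamma_error (s n)"
    unfolding saddle_log_equations_digamma_error(1)[OF sp] by (simp add: algebra_simps)
  moreover have "r n * (ln (s n) - ln (r n)) = r n * ((m n + 1 / 2) / s n) - (u n - 1 / 2)
      + r n * digamma_error (r n) - r n * digamma_error (s n)"
  proof -
    have "r n * ((u n - 1 / 2) / r n) = u n - 1 / 2" using pos by simp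
    then show ?thesis
      unfolding saddle_log_equations_digamma_error(2)[OF sp] distrib_left right_diff_distrib
      by simp
  qed
  moreover have "exponent n =
      m n * ((m n + 1 / 2) / s n) + r n * ((m n + 1 / 2) / s n) - u n + 3 / 2"
  proof -
    have n: "real n = m n + r n + s n" and t: "t n = m n - u n" by (simp_all add: m_def u_def)
    show ?thesis unfolding exponent_def n t using pos by (simp add: field_simps)
  qed
  moreover have "m n * (- t n / m n) = - t n" "m n * (1 / r n) = m n / r n" using pos by simp_all
  ultimately show ?thesis
    unfolding leading_error_def ln1p_error_def right_diff_distrib by linarith
qed

lemma leading_error_tendsto: "leading_error \<longlonglongrightarrow> 0"
proof -
  have m: "m \<in> O(real)" and r: "r \<in> O(real)"
    using asymp_equiv_imp_bigo[OF m_asymp_equiv] asymp_equiv_imp_bigo[OF r_asymp_equiv]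
      landau_o.small_imp_big[OF centre_smallo] landau_o.big_trans
    by blast+
  have error_m: "(\<lambda>n. m n * digamma_error (u n)) \<longlonglongrightarrow> 0"
    by (rule mult_digamma_error_tendsto[OF m u_asymp_equiv filterlim_real_sequentially]) real_asymp
  have error: "(\<lambda>n. k n * digamma_error (f n)) \<longlonglongrightarrow> 0"
    if "k \<in> O(real)" "f \<sim>[sequentially] centre" for k f
    using that
    by (rule mult_digamma_error_tendsto[OF _ _ centre_at_top]) (unfold centre_def, real_asymp)
  have ratio: "(\<lambda>n. f n) \<longlonglongrightarrow> l"
    if "f \<sim>[sequentially] g" "g \<longlonglongrightarrow> l" for f g :: "nat \<Rightarrow> real" and l
    using that tendsto_asymp_equiv_cong by blast
  have ln_t: "(\<lambda>n. m n * ln1p_error (- t n / m n)) \<longlonglongrightarrow> 0"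
  proof (rule mult_ln1p_error_tendsto)
    note t_over_m = asymp_equiv_divide[OF asymp_equiv_uminus[OF t_asymp_equiv] m_asymp_equiv]
    show "(\<lambda>n. - t n / m n) \<longlonglongrightarrow> 0" by (rule ratio[OF t_over_m]) real_asymp
    show "(\<lambda>n. m n * (- t n / m n)\<^sup>2) \<longlonglongrightarrow> 0"
      by (rule ratio[OF asymp_equiv_mult[OF m_asymp_equiv asymp_equiv_power[OF t_over_m]]])
         real_asymp
  qed
  have ln_r: "(\<lambda>n. m n * ln1p_error (1 / r n)) \<longlonglongrightarrow> 0"
  proof (rule mult_ln1p_error_tendsto)
    note inverse_r = asymp_equiv_divide[OF asymp_equiv_refl r_asymp_equiv]
    show "(\<lambda>n. 1 / r n) \<longlonglongrightarrow> 0"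
      by (rule ratio[OF inverse_r]) (unfold centre_def, real_asymp)
    show "(\<lambda>n. m n * (1 / r n)\<^sup>2) \<longlonglongrightarrow> 0"
      by (rule ratio[OF asymp_equiv_mult[OF m_asymp_equiv asymp_equiv_power[OF inverse_r]]])
         (unfold centre_def, real_asymp)
  qed
  have "(\<lambda>n. m n / u n) \<longlonglongrightarrow> 1"
    by (rule ratio[OF asymp_equiv_divide[OF m_asymp_equiv u_asymp_equiv]]) real_asymp
  then have "leading_error \<longlonglongrightarrow> 0 + 0 + 1 / 2 + 1 / 2 - 1 + (0 - 0) + (0 - 0)"
    unfolding leading_error_def [abs_def]
    by (intro tendsto_intros ln_t ln_r m_over_r_minus_t_tendsto error_m error m r r_asymp_equiv
        s_asymp_equiv) simp_all
  then show ?thesis by simp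
qed

lemma exp_peak_asymp_equiv:
  "(\<lambda>n. 2 * pi * exp (peak n)) \<sim>[sequentially] (\<lambda>n. exp (exponent n) * (real n / s n) ^ n)"
proof (rule asymp_equivI')
  define Q where "Q n = ln (2 * pi) + leading_error n
    + (ln (real n / m n) + ln (s n / r n)) / 2
    + (stirling_error n - stirling_error (r n) - stirling_error (s n) - stirling_error (m n))" for n
  have m_top: "filterlim m at_top sequentially"
    using asymp_equiv_symI[OF m_asymp_equiv] filterlim_real_sequentially
    by (rule asymp_equiv_at_top_transfer)
  have stirling: "(\<lambda>n. stirling_error (f n)) \<longlonglongrightarrow> ln (2 * pi) / 2"
    if "filterlim f at_top sequentially" for f :: "nat \<Rightarrow> real"
    by (rule filterlim_compose[OF stirling_error_tendsto that])
  have pos: "\<forall>\<^sub>F n in sequentially. r n > 0 \<and> s n > 0 \<and> m n > 0 \<and> n > 0"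
    using saddle eventually_gt_at_top[of 0]
    by eventually_elim (auto simp: saddle_point_iff m_def)
  have "(\<lambda>n. real n / m n) \<longlonglongrightarrow> 1" "(\<lambda>n. s n / r n) \<longlonglongrightarrow> 1"
    by (rule asymp_equivD_strong; use pos s_asymp_equiv_r asymp_equiv_symI[OF m_asymp_equiv] in
        \<open>auto elim: eventually_mono\<close>)+
  then have "Q \<longlonglongrightarrow> ln (2 * pi) + 0 + (ln 1 + ln 1) / 2
      + (ln (2 * pi) / 2 - ln (2 * pi) / 2 - ln (2 * pi) / 2 - ln (2 * pi) / 2)"
    unfolding Q_def [abs_def]
    by (intro tendsto_intros leading_error_tendsto stirling filterlim_real_sequentially
        r_at_top s_at_top m_top) auto
  then have "(\<lambda>n. exp (Q n)) \<longlonglongrightarrow> exp 0" by (intro tendsto_exp) simp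
  moreover have "\<forall>\<^sub>F n in sequentially.
      exp (Q n) = 2 * pi * exp (peak n) / (exp (exponent n) * (real n / s n) ^ n)"
    using pos saddle
  proof eventually_elim
    case (elim n)
    then have "(real n / s n) ^ n = exp (real n * ln (real n / s n))" by (simp add: exp_of_nat_mult)
    moreover have "Q n = ln (2 * pi) + peak n - (exponent n + real n * ln (real n / s n))"
      using elim peak_eq_leading[of n] leading_eq_exponent[of n] by (simp add: Q_def)
    ultimately show ?case by (simp add: exp_add exp_diff)
  qed
  ultimately show "(\<lambda>n. 2 * pi * exp (peak n) / (exp (exponent n) * (real n / s n) ^ n)) \<longlonglongrightarrow> 1"
    by (simp add: tendsto_cong)
qed

lemma prefactor_asymp_equiv:
  "(\<lambda>n. r n powr (1 / 2) * s n powr (3 / 2) / real n)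
    \<sim>[sequentially] (\<lambda>n. real n / (4 * (ln (real n))\<^sup>2))"
proof -
  have nonneg: "\<forall>\<^sub>F n in sequentially. 0 \<le> r n \<and> 0 \<le> s n \<and> 0 \<le> centre n"
    using eventually_saddle_location eventually_ge_at_top[of 2]
    by eventually_elim (auto simp: centre_def)
  then have "(\<lambda>n. r n powr (1 / 2) * s n powr (3 / 2) / real n)
      \<sim>[sequentially] (\<lambda>n. centre n powr (1 / 2) * centre n powr (3 / 2) / real n)"
    by (intro asymp_equiv_intros r_asymp_equiv s_asymp_equiv) (auto elim: eventually_mono)
  also have "\<dots> \<sim>[sequentially] (\<lambda>n. real n / (4 * (ln (real n))\<^sup>2))"
  proof (rule asymp_equiv_refl_ev)
    show "\<forall>\<^sub>F n in sequentially.
        centre n powr (1 / 2) * centre n powr (3 / 2) / real n = real n / (4 * (ln (real n))\<^sup>2)"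
      using eventually_ge_at_top[of 2]
    proof eventually_elim
      case (elim n)
      have "centre n powr (1 / 2) * centre n powr (3 / 2) = (centre n)\<^sup>2"
        using centre_pos[OF elim] by (simp add: powr_add [symmetric] powr_numeral)
      then show ?case by (simp add: centre_def power_divide power_mult_distrib power2_eq_square)
    qed
  qed
  finally show ?thesis .
qed

lemma c_asymp_equiv:
  "c \<sim>[sequentially] (\<lambda>n. exp (exponent n) * (real n / s n) ^ n * (real n / (4 * (ln (real n))\<^sup>2)))"
proof -
  have "(\<lambda>n. 2 * pi * exp (peak n) * (width n)\<^sup>2)
      \<sim>[sequentially] (\<lambda>n. exp (exponent n) * (real n / s n) ^ n * (width n)\<^sup>2)"
    by (intro asymp_equiv_mult exp_peak_asymp_equiv asymp_equiv_refl)
  with c_asymp_equiv_peak show ?thesis unfolding width_square by (rule asymp_equiv_trans)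
qed

end

theorem theorem11:
  shows "(\<forall>\<^sub>F n in sequentially. \<exists>!(r, s, t). saddle_point n r s t) \<and>
    (\<forall>r s t :: nat \<Rightarrow> real.
      (\<forall>\<^sub>F n in sequentially. saddle_point n (r n) (s n) (t n)) \<longrightarrow>
      c \<sim>[sequentially]
        (\<lambda>n. exp (real n / s n * (real n - r n + 1 / 2) - 3 * real n + 2 * r n + 2 * s n + t n + 1)
               * (real n / s n) ^ n * (r n powr (1 / 2) * s n powr (3 / 2) / real n)) \<and>
      (\<lambda>n. exp (real n / s n * (real n - r n + 1 / 2) - 3 * real n + 2 * r n + 2 * s n + t n + 1)
               * (real n / s n) ^ n * (r n powr (1 / 2) * s n powr (3 / 2) / real n))
        \<sim>[sequentially]
        (\<lambda>n. exp (real n / s n * (real n - r n + 1 / 2) - 3 * real n + 2 * r n + 2 * s n + t n + 1)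
               * (real n / s n) ^ n * (real n / (4 * (ln (real n))\<^sup>2))))"
proof (intro conjI allI impI)
  show "\<forall>\<^sub>F n in sequentially. \<exists>!(r, s, t). saddle_point n r s t"
    by (rule eventually_saddle_point_ex1)
  fix r s t :: "nat \<Rightarrow> real"
  assume "\<forall>\<^sub>F n in sequentially. saddle_point n (r n) (s n) (t n)"
  then interpret saddle_sequence r s t by unfold_locales
  let ?F = "\<lambda>n.
    exp (real n / s n * (real n - r n + 1 / 2) - 3 * real n + 2 * r n + 2 * s n + t n + 1)
      * (real n / s n) ^ n"
  show prefactors: "(\<lambda>n. ?F n * (r n powr (1 / 2) * s n powr (3 / 2) / real n))
      \<sim>[sequentially] (\<lambda>n. ?F n * (real n / (4 * (ln (real n))\<^sup>2)))"
    by (intro asymp_equiv_mult asymp_equiv_refl prefactor_asymp_equiv)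
  show "c \<sim>[sequentially] (\<lambda>n. ?F n * (r n powr (1 / 2) * s n powr (3 / 2) / real n))"
    using c_asymp_equiv asymp_equiv_symI[OF prefactors] unfolding exponent_def
    by (rule asymp_equiv_trans)
qed

end
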